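(* Let $n\geq 0$ and let $U=X(0,1)^{-}\times X(2,3)^{-}\times\cdots\times X(2n,2n+1)^{-}$. For each $0\leq i\leq n$, fix decompositions $\aleph_{2i}=E_{2i}\amalg F_{2i}$ and $\aleph_{2i+1}=E_{2i+1}\amalg F_{2i+1}$ into two subsets of equal cardinality, let $\epsilon_{i}\in H^{1}(X(2i,2i+1)^{-};\mathbf{F}_{2})$ be the class represented by the function $e_{i}\colon\aleph_{2i}\times\aleph_{2i+1}\to\mathbf{F}_{2}$ with $e_{i}(x,y)=1$ if $x\in E_{2i}$ and $y\in E_{2i+1}$ and $0$ otherwise, and let $\eta_{i}\in H^{1}(U;\mathbf{F}_{2})$ be the pullback of $\epsilon_{i}$ along the $i$th projection $U\to X(2i,2i+1)^{-}$. Then the cup product $\eta_{0}\cdots\eta_{n}\in H^{n+1}(U;\mathbf{F}_{2})$ is nonzero.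
   Context: For an infinite cardinal $\kappa$, $\kappa^{+}$ is the one-point compactification of the discrete space $\kappa$ with added point $\infty$; $X(a,b)=(\aleph_{a})^{+}\times(\aleph_{b})^{+}$ and $X(a,b)^{-}=X(a,b)\setminus\{(\infty,\infty)\}$. Cohomology is sheaf cohomology with coefficients in the constant sheaf $\mathbf{F}_{2}$. The class represented by a function $g\colon\aleph_{a}\times\aleph_{b}\to\mathbf{F}_{2}$: $X(a,b)^{-}$ is covered by the open sets $V$ (first coordinate $\neq\infty$) and $W$ (second coordinate $\neq\infty$) with $V\cap W=\aleph_{a}\times\aleph_{b}$ discrete; $g$ is a Čech $1$-cocycle for this cover, and $H^{1}(X(a,b)^{-};\mathbf{F}_{2})$ is the space of all such $g$ modulo sums $g_{0}+g_{1}$ with $g_{j}$ constant, up to a finite set, in the $j$th variable for each fixed value of the other variable. *)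

theory Defs
  imports "HOL-Analysis.Analysis" "HOL-Algebra.Coset" "HOL-Library.Z2"
begin

unbundle cardinal_syntax
no_notation (input) elt_set_eq (infix \<open>=o\<close> 50)

section \<open>Sheaf cohomology with constant coefficients\<close>

text \<open>
  Sheaf cohomology is computed by Godement's canonical cosimplicial flasque resolution
  (R. Godement, Topologie algebrique et theorie des faisceaux, II.6.4).  Write
  \<open>G \<F>\<close> for the sheaf of discontinuous sections, \<open>(G \<F>)(V) = (\<Prod>x\<in>V. \<F>\<^sub>x)\<close>,
  and let \<open>k\<close> be the constant sheaf.  The complex is
  \<open>G k \<rightarrow> G (G k) \<rightarrow> G (G (G k)) \<rightarrow> \<dots>\<close>, whose differential is the alternating sum of the
  unit maps \<open>\<F> \<rightarrow> G \<F>\<close> inserted in all positions.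

  Following Godement, sections are represented by functions of points.  A section over \<open>V\<close> of the
  \<open>p\<close>-th sheaf (\<open>G\<close> applied \<open>p + 1\<close> times to \<open>k\<close>) has a component at every \<open>x\<^sub>0 \<in> V\<close>: for \<open>p = 0\<close> an
  element of the stalk \<open>k\<close>, and for \<open>p > 0\<close> the germ at \<open>x\<^sub>0\<close> of a section of the \<open>(p - 1)\<close>-st sheaf.
  All these sheaves are flasque, so that germ comes from a global section, and inductively
  the whole section comes from a function \<open>f\<close> of \<open>(x\<^sub>0, \<dots>, x\<^sub>p)\<close>, here a function on lists of which
  only the values on lists of length \<open>p + 1\<close> matter.  The predicate below says that the component at
  \<open>x\<close> of the section represented by \<open>f\<close> is zero; two functions represent the same section iff their
  difference satisfies it at all points.
\<close>

primrec vanishes_at :: "'x topology \<Rightarrow> nat \<Rightarrow> 'x \<Rightarrow> ('x list \<Rightarrow> 'k::zero) \<Rightarrow> bool" where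
  "vanishes_at X 0 x f \<longleftrightarrow> f [x] = 0"
| "vanishes_at X (Suc p) x f \<longleftrightarrow> (\<forall>\<^sub>F y in nhdsin X x. vanishes_at X p y (\<lambda>ys. f (x # ys)))"

definition null_sections :: "'x topology \<Rightarrow> nat \<Rightarrow> 'x set \<Rightarrow> ('x list \<Rightarrow> 'k::zero) set" where
  "null_sections X p V = {f. \<forall>x\<in>V. vanishes_at X p x f}"

text \<open>Inserting the unit in position \<open>i\<close> is, on representatives, forgetting the variable \<open>x\<^sub>i\<close>.\<close>

definition coboundary :: "('x list \<Rightarrow> 'k::comm_ring_1) \<Rightarrow> 'x list \<Rightarrow> 'k" where
  "coboundary f xs = (\<Sum>i<length xs. (- 1) ^ i * f (take i xs @ drop (Suc i) xs))"

text \<open>Cocycles and coboundaries among the global sections, as sets of representatives; the functions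
  representing the zero section are therefore contained in both.\<close>

definition cocycles :: "'x topology \<Rightarrow> nat \<Rightarrow> ('x list \<Rightarrow> 'k::comm_ring_1) set" where
  "cocycles X p = {f. coboundary f \<in> null_sections X (Suc p) (topspace X)}"

fun coboundaries :: "'x topology \<Rightarrow> nat \<Rightarrow> ('x list \<Rightarrow> 'k::comm_ring_1) set" where
  "coboundaries X 0 = null_sections X 0 (topspace X)"
| "coboundaries X (Suc p) =
     {f. \<exists>h. (\<lambda>xs. f xs - coboundary h xs) \<in> null_sections X (Suc p) (topspace X)}"

definition cocycle_group :: "'x topology \<Rightarrow> nat \<Rightarrow> ('x list \<Rightarrow> 'k::comm_ring_1) monoid" where
  "cocycle_group X p =
     \<lparr>carrier = cocycles X p, monoid.mult = (\<lambda>f g xs. f xs + g xs), one = (\<lambda>xs. 0)\<rparr>"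

text \<open>The group law is addition, so \<open>\<one>\<close> of the following group is the zero class.\<close>

definition cohomology_group :: "'x topology \<Rightarrow> nat \<Rightarrow> ('x list \<Rightarrow> 'k::comm_ring_1) set monoid" where
  "cohomology_group X p = cocycle_group X p Mod coboundaries X p"

definition cohomology_class ::
    "'x topology \<Rightarrow> nat \<Rightarrow> ('x list \<Rightarrow> 'k::comm_ring_1) \<Rightarrow> ('x list \<Rightarrow> 'k) set" where
  "cohomology_class X p f = coboundaries X p #>\<^bsub>cocycle_group X p\<^esub> f"

text \<open>Operations on classes are defined through representatives; the unions below are over equal
  sets.\<close>

definition pullback ::
    "'y topology \<Rightarrow> nat \<Rightarrow> ('y \<Rightarrow> 'x) \<Rightarrow> ('x list \<Rightarrow> 'k::comm_ring_1) set \<Rightarrow> ('y list \<Rightarrow> 'k) set" where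
  "pullback Y p \<phi> \<alpha> = (\<Union>f\<in>\<alpha>. cohomology_class Y p (\<lambda>ys. f (map \<phi> ys)))"

text \<open>Godement's cup product (II.6.6): on representatives,
  \<open>(x\<^sub>0, \<dots>, x\<^bsub>p+q\<^esub>) \<mapsto> f (x\<^sub>0, \<dots>, x\<^sub>p) * g (x\<^sub>p, \<dots>, x\<^bsub>p+q\<^esub>)\<close>.\<close>

definition cup ::
    "'x topology \<Rightarrow> nat \<Rightarrow> nat \<Rightarrow> ('x list \<Rightarrow> 'k::comm_ring_1) set \<Rightarrow> ('x list \<Rightarrow> 'k) set
      \<Rightarrow> ('x list \<Rightarrow> 'k) set" where
  "cup X p q \<alpha> \<beta> =
     (\<Union>f\<in>\<alpha>. \<Union>g\<in>\<beta>. cohomology_class X (p + q) (\<lambda>xs. f (take (Suc p) xs) * g (drop p xs)))"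

text \<open>The product \<open>\<eta> 0 \<cdots> \<eta> n\<close> of classes of degree \<open>1\<close>, in degree \<open>n + 1\<close>.\<close>

primrec cup_prod ::
    "'x topology \<Rightarrow> (nat \<Rightarrow> ('x list \<Rightarrow> 'k::comm_ring_1) set) \<Rightarrow> nat \<Rightarrow> ('x list \<Rightarrow> 'k) set" where
  "cup_prod X \<eta> 0 = \<eta> 0"
| "cup_prod X \<eta> (Suc n) = cup X (Suc n) 1 (cup_prod X \<eta> n) (\<eta> (Suc n))"

text \<open>
  The image in \<open>H\<^sup>1\<close> of the Cech cocycle \<open>g\<close> of a cover of \<open>X\<close> by two open sets \<open>V\<close>, \<open>W\<close>:
  write \<open>g = h\<^sub>W - h\<^sub>V\<close> on \<open>V \<inter> W\<close> with sections \<open>h\<^sub>V\<close>, \<open>h\<^sub>W\<close> of the zeroth Godement sheaf over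
  \<open>V\<close>, \<open>W\<close>; as \<open>g\<close> is locally constant, \<open>d h\<^sub>V\<close> and \<open>d h\<^sub>W\<close> glue to a global \<open>1\<close>-cocycle \<open>c\<close>.  The
  class is the set of all \<open>c\<close> obtained in this way.
\<close>

definition cech_class ::
    "'x topology \<Rightarrow> 'x set \<Rightarrow> 'x set \<Rightarrow> ('x \<Rightarrow> 'k::comm_ring_1) \<Rightarrow> ('x list \<Rightarrow> 'k) set" where
  "cech_class X V W g =
     {c. \<exists>hV hW. (\<forall>x\<in>V \<inter> W. g x = hW [x] - hV [x]) \<and>
           (\<lambda>xs. c xs - coboundary hV xs) \<in> null_sections X 1 V \<and>
           (\<lambda>xs. c xs - coboundary hW xs) \<in> null_sections X 1 W}"


section \<open>The complex above is a resolution of the constant sheaf\<close>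

lemma coboundary_Nil: "coboundary f [] = 0"
  by (simp add: coboundary_def)

lemma coboundary_Cons: "coboundary f (x # ys) = f ys - coboundary (\<lambda>zs. f (x # zs)) ys"
  by (simp add: coboundary_def sum.lessThan_Suc_shift sum_negf del: sum.lessThan_Suc)

lemma coboundary_diff:
  "coboundary (\<lambda>xs. f xs - g xs) ys = coboundary f ys - coboundary g ys"
  by (simp add: coboundary_def sum_subtractf algebra_simps)

lemma coboundary_coboundary: "coboundary (coboundary f) xs = 0"
proof (induction xs arbitrary: f)
  case Nil
  then show ?case by (simp add: coboundary_Nil)
next
  case (Cons x xs)
  have "(\<lambda>zs. coboundary f (x # zs)) = (\<lambda>zs. f zs - coboundary (\<lambda>ws. f (x # ws)) zs)"
    by (simp add: coboundary_Cons)
  then show ?case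
    using Cons by (simp add: coboundary_Cons[of "coboundary f"] coboundary_diff)
qed

lemma vanishes_at_diff:
  fixes f g :: "'x list \<Rightarrow> 'k::comm_ring_1"
  shows "vanishes_at X p x f \<Longrightarrow> vanishes_at X p x g \<Longrightarrow> vanishes_at X p x (\<lambda>xs. f xs - g xs)"
proof (induction p arbitrary: x f g)
  case (Suc p)
  then show ?case
    by (simp add: eventually_elim2[OF _ _ Suc.IH])
qed simp

lemma eventually_nhdsinD:
  assumes "\<forall>\<^sub>F y in nhdsin X x. P y" "x \<in> topspace X"
  shows "\<exists>S. openin X S \<and> x \<in> S \<and> (\<forall>y\<in>S. P y)"
  using assms unfolding eventually_nhdsin by blast

text \<open>The differential is well defined on sections over open sets.\<close>

lemma coboundary_null_sections:
  assumes "openin X V" "f \<in> null_sections X p V"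
  shows "coboundary f \<in> null_sections X (Suc p) V"
  using assms
proof (induction p arbitrary: V f)
  case 0
  have "\<forall>\<^sub>F y in nhdsin X x. f [y] - f [x] = 0" if "x \<in> V" for x
    unfolding eventually_nhdsin using 0 that by (auto simp: null_sections_def)
  then show ?case
    by (simp add: null_sections_def coboundary_Cons coboundary_Nil)
next
  case (Suc p)
  show ?case
    unfolding null_sections_def
  proof safe
    fix x assume x: "x \<in> V"
    have "\<forall>\<^sub>F y in nhdsin X x. vanishes_at X p y (\<lambda>ys. f (x # ys))"
      using Suc.prems x by (simp add: null_sections_def)
    moreover have "x \<in> topspace X"
      using openin_subset[OF Suc.prems(1)] x by blast
    ultimately obtain S where S: "openin X S" "x \<in> S"
      and van: "\<And>y. y \<in> S \<Longrightarrow> vanishes_at X p y (\<lambda>ys. f (x # ys))"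
      using eventually_nhdsinD by meson
    have d: "coboundary (\<lambda>ys. f (x # ys)) \<in> null_sections X (Suc p) S"
      by (rule Suc.IH[OF S(1)]) (simp add: null_sections_def van)
    have "vanishes_at X (Suc p) y (\<lambda>ys. coboundary f (x # ys))" if "y \<in> S \<inter> V" for y
    proof -
      have "vanishes_at X (Suc p) y f"
        using Suc.prems that by (simp add: null_sections_def)
      moreover have "vanishes_at X (Suc p) y (coboundary (\<lambda>ys. f (x # ys)))"
        using d that unfolding null_sections_def by blast
      ultimately show ?thesis
        unfolding coboundary_Cons by (rule vanishes_at_diff)
    qed
    moreover have "openin X (S \<inter> V)" "x \<in> S \<inter> V"
      using S Suc.prems x by auto
    ultimately have "\<forall>\<^sub>F y in nhdsin X x. vanishes_at X (Suc p) y (\<lambda>ys. coboundary f (x # ys))"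
      unfolding eventually_nhdsin by (intro disjI2 exI[of _ "S \<inter> V"]) blast
    then show "vanishes_at X (Suc (Suc p)) x (coboundary f)"
      by (simp only: vanishes_at.simps(2)[of X "Suc p"])
  qed
qed

text \<open>The kernel of the first differential is the constant sheaf: the locally constant functions.\<close>

lemma kernel_coboundary_0:
  "coboundary f \<in> null_sections X 1 V \<longleftrightarrow> (\<forall>x\<in>V. \<forall>\<^sub>F y in nhdsin X x. f [y] = f [x])"
  by (simp add: null_sections_def coboundary_Cons coboundary_Nil)

text \<open>Exactness of the sequence of sheaves in positive degrees: a cocycle on an open set is
  a coboundary near every point of it.\<close>

lemma coboundary_locally_exact:
  assumes "openin X V" "coboundary f \<in> null_sections X (Suc p) V" "x \<in> V"
  obtains S h where "openin X S" "x \<in> S" "S \<subseteq> V"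
    "(\<lambda>xs. f xs - coboundary h xs) \<in> null_sections X p S"
proof -
  have "\<forall>\<^sub>F y in nhdsin X x. vanishes_at X p y (\<lambda>ys. coboundary f (x # ys))"
    using assms by (simp add: null_sections_def)
  then have "\<forall>\<^sub>F y in nhdsin X x. vanishes_at X p y (\<lambda>ys. f ys - coboundary (\<lambda>zs. f (x # zs)) ys)"
    by (simp only: coboundary_Cons)
  moreover have "x \<in> topspace X"
    using openin_subset[OF assms(1)] assms(3) by blast
  ultimately obtain S where S: "openin X S" "x \<in> S"
    and van: "\<And>y. y \<in> S \<Longrightarrow> vanishes_at X p y (\<lambda>ys. f ys - coboundary (\<lambda>zs. f (x # zs)) ys)"
    using eventually_nhdsinD by meson
  show thesis
  proof (rule that)
    show "openin X (S \<inter> V)" "x \<in> S \<inter> V" "S \<inter> V \<subseteq> V"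
      using S assms(1,3) by auto
    show "(\<lambda>xs. f xs - coboundary (\<lambda>zs. f (x # zs)) xs) \<in> null_sections X p (S \<inter> V)"
      using van by (simp add: null_sections_def)
  qed
qed


section \<open>The spaces\<close>

text \<open>\<open>A\<close> has cardinality aleph \<open>k\<close>.\<close>

primrec has_card_aleph :: "nat \<Rightarrow> 'a set \<Rightarrow> bool" where
  "has_card_aleph 0 A \<longleftrightarrow> |A| =o natLeq"
| "has_card_aleph (Suc k) A \<longleftrightarrow> (\<exists>B::'a set. has_card_aleph k B \<and> |A| =o cardSuc |B| )"

text \<open>\<open>A\<^sup>+ \<times> B\<^sup>+\<close> without \<open>(\<infinity>, \<infinity>)\<close>, for discrete \<open>A\<close> and \<open>B\<close>; the point \<open>\<infinity>\<close> is \<open>None\<close>.\<close>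

definition punctured :: "'a set \<Rightarrow> 'b set \<Rightarrow> ('a option \<times> 'b option) topology" where
  "punctured A B =
     (let X = prod_topology (Alexandroff_compactification (discrete_topology A))
                            (Alexandroff_compactification (discrete_topology B))
      in subtopology X (topspace X - {(None, None)}))"

definition represented_class ::
    "'a set \<Rightarrow> 'b set \<Rightarrow> ('a \<Rightarrow> 'b \<Rightarrow> 'k::comm_ring_1) \<Rightarrow> (('a option \<times> 'b option) list \<Rightarrow> 'k) set" where
  "represented_class A B g =
     cech_class (punctured A B)
       {z \<in> topspace (punctured A B). fst z \<noteq> None}
       {z \<in> topspace (punctured A B). snd z \<noteq> None}
       (\<lambda>z. g (the (fst z)) (the (snd z)))"

end

theory Submission
  imports Defs "HOL-Combinatorics.Permutations"
begin

text \<open>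
  Write \<open>k\<close> for the index of one of the \<open>2n + 2\<close> variables.  Given a point \<open>z\<close> of the product of all
  \<open>A k\<close>, a choice for each \<open>i\<close> of the variable of the \<open>i\<close>-th factor to be sent to infinity, and an
  order \<open>\<sigma>\<close> of the factors, there is a flag of \<open>n + 2\<close> points of \<open>U\<close>: all factors start at infinity
  and return to \<open>z\<close> one at a time in the order \<open>\<sigma>\<close>.  If the cup product, represented by \<open>f\<close>, were the
  coboundary of \<open>h\<close> up to a null section, then \<open>f = d h\<close> on every flag of \<open>z\<close>, unless some \<open>z k\<close> lies
  in a finite set determined by the other variables.  As \<open>A k\<close> has cardinality aleph \<open>k\<close>, there
  are pairs \<open>a k \<in> E k\<close>, \<open>b k \<in> F k\<close> such that no point of the box they span is exceptional.  Sum
  over all flags of all points of the box, modulo 2.  The terms of \<open>d h\<close> cancel in pairs: omitting the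
  first point of a flag forgets which variable of the first factor was infinite, omitting a
  middle point forgets the order of two factors, and omitting the last point forgets one variable
  of \<open>z\<close>.  But \<open>f\<close> is nonzero on exactly one of these flags, one of the point \<open>a\<close>.
\<close>

section \<open>Operations on Godement cochains\<close>

text \<open>The recursion reads only lists of length \<open>p + 1\<close> that start at
  \<open>x\<close>. Cochain identities such as the Leibniz rule hold only for lists of suitable
  length, and this is how they carry over to null sections.\<close>

lemma vanishes_at_cong:
  assumes "\<And>xs. length xs = Suc p \<Longrightarrow> hd xs = x \<Longrightarrow> f xs = g xs"
  shows "vanishes_at X p x f \<longleftrightarrow> vanishes_at X p x g"
  using assms
proof (induction p arbitrary: x f g)
  case (Suc p)
  have "vanishes_at X p y (\<lambda>ys. f (x # ys)) \<longleftrightarrow> vanishes_at X p y (\<lambda>ys. g (x # ys))" for y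
    by (rule Suc.IH) (simp add: Suc.prems)
  then show ?case
    by simp
qed simp

lemma null_sections_cong:
  assumes "\<And>xs. length xs = Suc p \<Longrightarrow> f xs = g xs" "f \<in> null_sections X p V"
  shows "g \<in> null_sections X p V"
  using assms vanishes_at_cong[of p _ f g X] by (auto simp: null_sections_def)

lemma vanishes_at_mult:
  fixes g :: "'x list \<Rightarrow> 'k::comm_ring_1"
  shows "vanishes_at X p x g \<Longrightarrow> vanishes_at X p x (\<lambda>xs. k xs * g xs)"
proof (induction p arbitrary: x g k)
  case (Suc p)
  from Suc.prems have "\<forall>\<^sub>F y in nhdsin X x. vanishes_at X p y (\<lambda>ys. g (x # ys))"
    by simp
  then have "\<forall>\<^sub>F y in nhdsin X x. vanishes_at X p y (\<lambda>ys. k (x # ys) * g (x # ys))"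
    by (rule eventually_mono) (rule Suc.IH)
  then show ?case
    by simp
qed simp

lemma vanishes_at_zero: "vanishes_at X p x (\<lambda>_. 0)"
  by (induction p arbitrary: x) simp_all

lemma null_sections_diff:
  fixes f g :: "'x list \<Rightarrow> 'k::comm_ring_1"
  shows "f \<in> null_sections X p V \<Longrightarrow> g \<in> null_sections X p V \<Longrightarrow>
    (\<lambda>xs. f xs - g xs) \<in> null_sections X p V"
  by (simp add: null_sections_def vanishes_at_diff)

lemma null_sections_mult:
  fixes g :: "'x list \<Rightarrow> 'k::comm_ring_1"
  shows "g \<in> null_sections X p V \<Longrightarrow> (\<lambda>xs. k xs * g xs) \<in> null_sections X p V"
  by (simp add: null_sections_def vanishes_at_mult)

lemma zero_null_sections: "(\<lambda>_. 0) \<in> null_sections X p V"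
  by (simp add: null_sections_def vanishes_at_zero)

lemma null_sections_add:
  fixes f g :: "'x list \<Rightarrow> 'k::comm_ring_1"
  assumes "f \<in> null_sections X p V" "g \<in> null_sections X p V"
  shows "(\<lambda>xs. f xs + g xs) \<in> null_sections X p V"
  using null_sections_diff[OF assms(1) null_sections_mult[OF assms(2), of "\<lambda>_. - 1"]] by simp

lemma coboundary_zero: "coboundary (\<lambda>_. 0) = (\<lambda>_. 0)"
  by (simp add: coboundary_def fun_eq_iff)

lemma coboundary_scale: "coboundary (\<lambda>xs. c * f xs) ys = c * coboundary f ys"
  by (simp add: coboundary_def sum_distrib_left ac_simps)

lemma null_sections_coboundaries:
  "f \<in> null_sections X p (topspace X) \<Longrightarrow> f \<in> coboundaries X p"
  by (cases p) (auto intro!: exI[of _ "\<lambda>_. 0"] simp: coboundary_zero)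

lemma coboundaries_diff:
  assumes "f \<in> coboundaries X p" "g \<in> coboundaries X p"
  shows "(\<lambda>xs. f xs - g xs) \<in> coboundaries X p"
proof (cases p)
  case 0
  then show ?thesis
    using assms by (simp add: null_sections_diff)
next
  case (Suc q)
  obtain h k where
    h: "(\<lambda>xs. f xs - coboundary h xs) \<in> null_sections X p (topspace X)" and
    k: "(\<lambda>xs. g xs - coboundary k xs) \<in> null_sections X p (topspace X)"
    using assms Suc by auto
  have "(\<lambda>xs. f xs - g xs - coboundary (\<lambda>xs. h xs - k xs) xs) \<in> null_sections X p (topspace X)"
    using null_sections_diff[OF h k] by (simp add: coboundary_diff algebra_simps)
  then show ?thesis
    using Suc by auto
qed

lemma zero_coboundaries: "(\<lambda>_. 0) \<in> coboundaries X p"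
  by (rule null_sections_coboundaries[OF zero_null_sections])

lemma coboundaries_uminus:
  assumes "f \<in> coboundaries X p"
  shows "(\<lambda>xs. - f xs) \<in> coboundaries X p"
  using coboundaries_diff[OF zero_coboundaries assms] by simp

lemma coboundaries_add:
  assumes "f \<in> coboundaries X p" "g \<in> coboundaries X p"
  shows "(\<lambda>xs. f xs + g xs) \<in> coboundaries X p"
  using coboundaries_diff[OF assms(1) coboundaries_uminus[OF assms(2)]] by simp

lemma coboundaries_cocycles:
  assumes "f \<in> coboundaries X (Suc p)"
  shows "f \<in> cocycles X (Suc p)"
proof -
  obtain h where h: "(\<lambda>xs. f xs - coboundary h xs) \<in> null_sections X (Suc p) (topspace X)"
    using assms by auto
  have "coboundary (\<lambda>xs. f xs - coboundary h xs) = coboundary f"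
    by (simp add: fun_eq_iff coboundary_diff coboundary_coboundary)
  then show ?thesis
    using coboundary_null_sections[OF openin_topspace h] by (simp add: cocycles_def)
qed

lemma cocycles_add:
  assumes "f \<in> cocycles X p" "g \<in> cocycles X p"
  shows "(\<lambda>xs. f xs + g xs) \<in> cocycles X p"
  using null_sections_add[of "coboundary f" X "Suc p" "topspace X" "coboundary g"] assms
  by (simp add: cocycles_def coboundary_def[abs_def] sum.distrib algebra_simps)

text \<open>The coset consists literally of the sums of a coboundary and \<open>f\<close>, so
  membership is a condition on the difference, for arbitrary functions \<open>f\<close> and
  \<open>g\<close>.\<close>

lemma mem_cohomology_class:
  "g \<in> cohomology_class X p f \<longleftrightarrow> (\<lambda>xs. g xs - f xs) \<in> coboundaries X p"
proof
  assume "g \<in> cohomology_class X p f"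
  then show "(\<lambda>xs. g xs - f xs) \<in> coboundaries X p"
    by (auto simp: cohomology_class_def r_coset_def cocycle_group_def)
next
  assume "(\<lambda>xs. g xs - f xs) \<in> coboundaries X p"
  then show "g \<in> cohomology_class X p f"
    unfolding cohomology_class_def r_coset_def cocycle_group_def
    by (auto intro!: bexI[of _ "\<lambda>xs. g xs - f xs"])
qed

lemma cohomology_class_self: "f \<in> cohomology_class X p f"
  by (simp add: mem_cohomology_class zero_coboundaries)

lemma cohomology_class_eq:
  assumes "g \<in> cohomology_class X p f"
  shows "cohomology_class X p g = cohomology_class X p f"
proof (rule Set.set_eqI)
  fix k
  have gf: "(\<lambda>xs. g xs - f xs) \<in> coboundaries X p"
    using assms by (simp add: mem_cohomology_class)
  show "k \<in> cohomology_class X p g \<longleftrightarrow> k \<in> cohomology_class X p f"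
    unfolding mem_cohomology_class
    using coboundaries_add[OF _ gf, of "\<lambda>xs. k xs - g xs"]
      coboundaries_diff[OF _ gf, of "\<lambda>xs. k xs - f xs"] by auto
qed

lemma cohomology_class_cocycles:
  assumes "g \<in> cohomology_class X (Suc p) f" "f \<in> cocycles X (Suc p)"
  shows "g \<in> cocycles X (Suc p)"
  using cocycles_add[OF coboundaries_cocycles assms(2), of "\<lambda>xs. g xs - f xs"] assms(1)
  by (simp only: mem_cohomology_class diff_add_cancel)

section \<open>Cup products of cochains and of classes\<close>

definition cup_cochain ::
    "nat \<Rightarrow> ('x list \<Rightarrow> 'k::comm_ring_1) \<Rightarrow> ('x list \<Rightarrow> 'k) \<Rightarrow> 'x list \<Rightarrow> 'k" where
  "cup_cochain p f g = (\<lambda>xs. f (take (Suc p) xs) * g (drop p xs))"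

text \<open>Peeling off the first variable lowers the degree in step with the recursion of
  \<open>vanishes_at\<close>; the inductions on \<open>p\<close> below rest on this.\<close>

lemma cup_cochain_Suc_Cons:
  "cup_cochain (Suc p) f g (x # ys) = cup_cochain p (\<lambda>zs. f (x # zs)) g ys"
  by (simp add: cup_cochain_def)

lemma cup_cochain_diff_left:
  "cup_cochain p (\<lambda>xs. f xs - f' xs) g xs = cup_cochain p f g xs - cup_cochain p f' g xs"
  by (simp add: cup_cochain_def algebra_simps)

lemma cup_cochain_diff_right:
  "cup_cochain p f (\<lambda>xs. g xs - g' xs) xs = cup_cochain p f g xs - cup_cochain p f g' xs"
  by (simp add: cup_cochain_def algebra_simps)

text \<open>The left factor depends on the first \<open>p + 1\<close> variables only, so the product
  vanishes as soon as \<open>f\<close> does, whatever \<open>g\<close> is.\<close>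

lemma vanishes_at_cup_left:
  "vanishes_at X p x f \<Longrightarrow> vanishes_at X (p + q) x (cup_cochain p f g)"
proof (induction p arbitrary: x f)
  case 0
  have "vanishes_at X q x (cup_cochain 0 f g) \<longleftrightarrow> vanishes_at X q x (\<lambda>_. 0 :: 'b)"
  proof (rule vanishes_at_cong)
    fix xs :: "'a list"
    assume "length xs = Suc q" "hd xs = x"
    then have "take (Suc 0) xs = [x]"
      by (cases xs) auto
    then show "cup_cochain 0 f g xs = 0"
      using 0 by (simp add: cup_cochain_def)
  qed
  then show ?case
    by (simp add: vanishes_at_zero)
next
  case (Suc p)
  from Suc.prems have "\<forall>\<^sub>F y in nhdsin X x. vanishes_at X p y (\<lambda>ys. f (x # ys))"
    by simp
  then have "\<forall>\<^sub>F y in nhdsin X x.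
      vanishes_at X (p + q) y (cup_cochain p (\<lambda>ys. f (x # ys)) g)"
    by (rule eventually_mono) (rule Suc.IH)
  then show ?case
    by (simp add: cup_cochain_Suc_Cons)
qed

text \<open>The right factor starts at the point reached after \<open>p\<close> steps, which need
  not be \<open>x\<close>; hence the hypothesis on \<open>g\<close> over the whole space.\<close>

lemma vanishes_at_cup_right:
  assumes "g \<in> null_sections X q (topspace X)"
  shows "x \<in> topspace X \<Longrightarrow> vanishes_at X (p + q) x (cup_cochain p f g)"
proof (induction p arbitrary: x f)
  case 0
  then show ?case
    using assms vanishes_at_mult[of X q x g] by (simp add: null_sections_def cup_cochain_def)
next
  case (Suc p)
  have "\<forall>\<^sub>F y in nhdsin X x. y \<in> topspace X"
    using openin_topspace by (auto simp: eventually_nhdsin)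
  then have "\<forall>\<^sub>F y in nhdsin X x.
      vanishes_at X (p + q) y (cup_cochain p (\<lambda>ys. f (x # ys)) g)"
    by (rule eventually_mono) (rule Suc.IH)
  then show ?case
    by (simp add: cup_cochain_Suc_Cons)
qed

lemma null_sections_cup_left:
  "f \<in> null_sections X p V \<Longrightarrow> cup_cochain p f g \<in> null_sections X (p + q) V"
  by (simp add: null_sections_def vanishes_at_cup_left)

lemma null_sections_cup_right:
  assumes "g \<in> null_sections X q (topspace X)"
  shows "cup_cochain p f g \<in> null_sections X (p + q) (topspace X)"
  using vanishes_at_cup_right[OF assms] by (simp add: null_sections_def)

text \<open>The graded Leibniz rule: the last summand of \<open>coboundary f\<close> and the first
  one of \<open>coboundary g\<close> cancel. The length bound provides the \<open>p + 2\<close>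
  entries that \<open>coboundary f\<close> reads.\<close>

lemma coboundary_cup:
  "length xs \<ge> p + 2 \<Longrightarrow> coboundary (cup_cochain p f g) xs =
     cup_cochain (Suc p) (coboundary f) g xs + (- 1) ^ p * cup_cochain p f (coboundary g) xs"
proof (induction p arbitrary: f xs)
  case 0
  then obtain x y zs where "xs = x # y # zs"
    by (auto simp: Suc_le_length_iff numeral_2_eq_2)
  then show ?case
    by (simp add: coboundary_Cons coboundary_Nil cup_cochain_def coboundary_scale algebra_simps)
next
  case (Suc p)
  then obtain x ys where xs: "xs = x # ys" "length ys \<ge> p + 2"
    by (cases xs) auto
  show ?case
    unfolding xs(1) coboundary_Cons cup_cochain_Suc_Cons Suc.IH[OF xs(2)]
    by (simp add: cup_cochain_Suc_Cons cup_cochain_diff_left coboundary_Cons)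
qed

lemma cup_cocycles:
  assumes "f \<in> cocycles X p" "g \<in> cocycles X q"
  shows "cup_cochain p f g \<in> cocycles X (p + q)"
proof -
  have "(\<lambda>xs. cup_cochain (Suc p) (coboundary f) g xs
        + (- 1) ^ p * cup_cochain p f (coboundary g) xs) \<in> null_sections X (Suc p + q) (topspace X)"
    using assms null_sections_cup_right[of "coboundary g" X "Suc q" p f]
    by (intro null_sections_add null_sections_mult null_sections_cup_left)
      (simp_all add: cocycles_def)
  then have "coboundary (cup_cochain p f g) \<in> null_sections X (Suc p + q) (topspace X)"
    by (rule null_sections_cong[rotated]) (simp add: coboundary_cup)
  then show ?thesis
    by (simp add: cocycles_def)
qed

text \<open>If \<open>f\<close> is \<open>coboundary h\<close> up to a null section, then
  \<open>cup_cochain p h g\<close> is a primitive of the product up to null sections: the other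
  Leibniz term contains \<open>coboundary g\<close>, which is null.\<close>

lemma cup_coboundaries_left:
  assumes "f \<in> coboundaries X (Suc p)" "g \<in> cocycles X q"
  shows "cup_cochain (Suc p) f g \<in> coboundaries X (Suc p + q)"
proof -
  obtain h where h: "(\<lambda>xs. f xs - coboundary h xs) \<in> null_sections X (Suc p) (topspace X)"
    using assms by auto
  have "(\<lambda>xs. cup_cochain (Suc p) (\<lambda>xs. f xs - coboundary h xs) g xs
      - (- 1) ^ p * cup_cochain p h (coboundary g) xs) \<in> null_sections X (Suc p + q) (topspace X)"
    using assms null_sections_cup_right[of "coboundary g" X "Suc q" p h]
    by (intro null_sections_diff null_sections_mult null_sections_cup_left h)
      (simp_all add: cocycles_def)
  then have "(\<lambda>xs. cup_cochain (Suc p) f g xs - coboundary (cup_cochain p h g) xs)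
      \<in> null_sections X (Suc p + q) (topspace X)"
    by (rule null_sections_cong[rotated]) (simp add: coboundary_cup cup_cochain_diff_left)
  then show ?thesis
    by auto
qed

text \<open>The primitive is \<open>(- 1) ^ p\<close> times the product of \<open>f\<close> with a
  primitive of \<open>g\<close>; its sign cancels the one in the Leibniz rule.\<close>

lemma cup_coboundaries_right:
  assumes "f \<in> cocycles X p" "g \<in> coboundaries X (Suc q)"
  shows "cup_cochain p f g \<in> coboundaries X (p + Suc q)"
proof -
  obtain h where h: "(\<lambda>xs. g xs - coboundary h xs) \<in> null_sections X (Suc q) (topspace X)"
    using assms by auto
  have 1: "cup_cochain p f (\<lambda>xs. g xs - coboundary h xs) \<in> null_sections X (Suc p + q) (topspace X)"
    using null_sections_cup_right[OF h, of p f] by simp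
  have "(\<lambda>xs. cup_cochain p f (\<lambda>xs. g xs - coboundary h xs) xs
      - (- 1) ^ p * cup_cochain (Suc p) (coboundary f) h xs)
      \<in> null_sections X (Suc p + q) (topspace X)"
    using assms
    by (intro null_sections_diff[OF 1] null_sections_mult null_sections_cup_left)
      (simp add: cocycles_def)
  moreover have "cup_cochain p f (\<lambda>xs. g xs - coboundary h xs) xs
      - (- 1) ^ p * cup_cochain (Suc p) (coboundary f) h xs
      = cup_cochain p f g xs - coboundary (\<lambda>xs. (- 1) ^ p * cup_cochain p f h xs) xs"
    if "length xs = Suc (Suc p + q)" for xs
  proof -
    have "(- 1) ^ p * ((- 1) ^ p * c) = c" for c :: 'b
      by (simp flip: mult.assoc power_add add: mult_2[symmetric])
    then show ?thesis
      using that
      by (simp add: coboundary_scale coboundary_cup cup_cochain_diff_right algebra_simps)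
  qed
  ultimately have "(\<lambda>xs. cup_cochain p f g xs
      - coboundary (\<lambda>xs. (- 1) ^ p * cup_cochain p f h xs) xs)
      \<in> null_sections X (Suc p + q) (topspace X)"
    by (rule null_sections_cong[rotated])
  then show ?thesis
    by auto
qed

text \<open>The unions in \<open>cup\<close> are over equal classes because
  \<open>f' g' - f g = (f' - f) g' + f (g' - g)\<close>, where both summands are
  coboundaries.\<close>

lemma cup_cohomology_class:
  assumes "f \<in> cocycles X (Suc p)" "g \<in> cocycles X (Suc q)"
  shows "cup X (Suc p) (Suc q) (cohomology_class X (Suc p) f) (cohomology_class X (Suc q) g) =
    cohomology_class X (Suc p + Suc q) (cup_cochain (Suc p) f g)"
proof -
  have "cohomology_class X (Suc p + Suc q) (cup_cochain (Suc p) f' g') =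
      cohomology_class X (Suc p + Suc q) (cup_cochain (Suc p) f g)"
    if f': "f' \<in> cohomology_class X (Suc p) f" and g': "g' \<in> cohomology_class X (Suc q) g" for f' g'
  proof (rule cohomology_class_eq)
    have "cup_cochain (Suc p) (\<lambda>xs. f' xs - f xs) g' \<in> coboundaries X (Suc p + Suc q)"
      using cohomology_class_cocycles[OF g' assms(2)] f'
      by (intro cup_coboundaries_left) (auto simp only: mem_cohomology_class)
    moreover have "cup_cochain (Suc p) f (\<lambda>xs. g' xs - g xs) \<in> coboundaries X (Suc p + Suc q)"
      using assms(1) g' by (intro cup_coboundaries_right) (auto simp only: mem_cohomology_class)
    ultimately show "cup_cochain (Suc p) f' g'
        \<in> cohomology_class X (Suc p + Suc q) (cup_cochain (Suc p) f g)"
      unfolding mem_cohomology_class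
      using coboundaries_add by (fastforce simp: cup_cochain_diff_left cup_cochain_diff_right
          simp del: coboundaries.simps)
  qed
  then show ?thesis
    unfolding cup_def cup_cochain_def[symmetric]
    by (intro SUP_eq_const) (use cohomology_class_self in \<open>blast+\<close>)
qed

section \<open>Pullback along continuous maps\<close>

lemma vanishes_at_map:
  assumes "continuous_map Y X \<phi>"
  shows "y \<in> topspace Y \<Longrightarrow> vanishes_at X p (\<phi> y) f \<Longrightarrow>
    vanishes_at Y p y (\<lambda>ys. f (map \<phi> ys))"
proof (induction p arbitrary: y f)
  case (Suc p)
  have "\<phi> y \<in> topspace X"
    using continuous_map_funspace[OF assms] Suc.prems(1) by auto
  moreover have "\<forall>\<^sub>F x in nhdsin X (\<phi> y). vanishes_at X p x (\<lambda>ys. f (\<phi> y # ys))"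
    using Suc.prems by simp
  ultimately obtain S where S: "openin X S" "\<phi> y \<in> S"
    and van: "\<And>x. x \<in> S \<Longrightarrow> vanishes_at X p x (\<lambda>ys. f (\<phi> y # ys))"
    using eventually_nhdsinD by meson
  have "openin Y {z \<in> topspace Y. \<phi> z \<in> S}"
    using assms S(1) by (rule openin_continuous_map_preimage)
  then have "\<forall>\<^sub>F z in nhdsin Y y. vanishes_at Y p z (\<lambda>ys. f (\<phi> y # map \<phi> ys))"
    unfolding eventually_nhdsin
    by (intro disjI2 exI[of _ "{z \<in> topspace Y. \<phi> z \<in> S}"])
      (use S Suc.prems in \<open>auto intro: Suc.IH[OF _ van]\<close>)
  then show ?case
    by simp
qed simp

lemma coboundary_map: "coboundary (\<lambda>ys. f (map \<phi> ys)) = (\<lambda>ys. coboundary f (map \<phi> ys))"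
  by (simp add: coboundary_def fun_eq_iff take_map drop_map)

lemma null_sections_map:
  assumes "continuous_map Y X \<phi>" "f \<in> null_sections X p (topspace X)"
  shows "(\<lambda>ys. f (map \<phi> ys)) \<in> null_sections Y p (topspace Y)"
  unfolding null_sections_def
proof (intro CollectI ballI)
  fix y assume y: "y \<in> topspace Y"
  then have "\<phi> y \<in> topspace X"
    using continuous_map_funspace[OF assms(1)] by auto
  then show "vanishes_at Y p y (\<lambda>ys. f (map \<phi> ys))"
    using assms y by (intro vanishes_at_map) (auto simp: null_sections_def)
qed

lemma cocycles_map:
  assumes "continuous_map Y X \<phi>" "f \<in> cocycles X p"
  shows "(\<lambda>ys. f (map \<phi> ys)) \<in> cocycles Y p"
  using null_sections_map[OF assms(1)] assms(2) by (auto simp: cocycles_def coboundary_map)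

lemma coboundaries_map:
  assumes "continuous_map Y X \<phi>" "f \<in> coboundaries X p"
  shows "(\<lambda>ys. f (map \<phi> ys)) \<in> coboundaries Y p"
proof (cases p)
  case 0
  then show ?thesis
    using assms null_sections_map[OF assms(1)] by auto
next
  case (Suc q)
  then obtain h where "(\<lambda>xs. f xs - coboundary h xs) \<in> null_sections X p (topspace X)"
    using assms by auto
  then have "(\<lambda>ys. f (map \<phi> ys) - coboundary (\<lambda>ys. h (map \<phi> ys)) ys)
      \<in> null_sections Y p (topspace Y)"
    using null_sections_map[OF assms(1)] by (auto simp: coboundary_map)
  then show ?thesis
    using Suc by auto
qed

lemma pullback_cohomology_class:
  assumes "continuous_map Y X \<phi>"
  shows "pullback Y p \<phi> (cohomology_class X p f) = cohomology_class Y p (\<lambda>ys. f (map \<phi> ys))"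
proof -
  have "cohomology_class Y p (\<lambda>ys. g (map \<phi> ys)) = cohomology_class Y p (\<lambda>ys. f (map \<phi> ys))"
    if "g \<in> cohomology_class X p f" for g
    using that coboundaries_map[OF assms]
    by (intro cohomology_class_eq) (auto simp: mem_cohomology_class)
  then show ?thesis
    unfolding pullback_def
    by (intro SUP_eq_const) (use cohomology_class_self in \<open>blast+\<close>)
qed

section \<open>Cech classes of covers by two open sets\<close>

text \<open>The cocycle obtained from \<open>hV = 0\<close> and from \<open>hW = g\<close> extended
  by zero outside \<open>V\<close>: it vanishes on lists starting in \<open>V\<close> and is the
  coboundary of \<open>hW\<close> on the others.\<close>

definition cech_cochain :: "'x set \<Rightarrow> ('x \<Rightarrow> 'k::comm_ring_1) \<Rightarrow> 'x list \<Rightarrow> 'k" where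
  "cech_cochain V g xs =
     (if hd xs \<in> V then 0 else coboundary (\<lambda>ys. if hd ys \<in> V then g (hd ys) else 0) xs)"

lemma null_sections_1:
  "f \<in> null_sections X 1 V \<longleftrightarrow> (\<forall>x\<in>V. \<forall>\<^sub>F y in nhdsin X x. f [x, y] = 0)"
  by (simp add: null_sections_def)

lemma eventually_nhdsin_openin:
  "openin X V \<Longrightarrow> x \<in> V \<Longrightarrow> \<forall>\<^sub>F y in nhdsin X x. y \<in> V"
  by (auto simp: eventually_nhdsin)

lemma cech_cochain_in_class:
  assumes "openin X V" "openin X W"
    and "\<And>x. x \<in> V \<inter> W \<Longrightarrow> \<forall>\<^sub>F y in nhdsin X x. g y = g x"
  shows "cech_cochain V g \<in> cech_class X V W g"
proof -
  define k where "k = (\<lambda>ys. if hd ys \<in> V then g (hd ys) else 0)"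
  have "(\<lambda>xs. cech_cochain V g xs - coboundary (\<lambda>_. 0) xs) \<in> null_sections X 1 V"
    unfolding null_sections_1 by (simp add: cech_cochain_def coboundary_zero)
  moreover have "(\<lambda>xs. cech_cochain V g xs - coboundary k xs) \<in> null_sections X 1 W"
    unfolding null_sections_1
  proof
    fix x assume x: "x \<in> W"
    show "\<forall>\<^sub>F y in nhdsin X x. cech_cochain V g [x, y] - coboundary k [x, y] = 0"
    proof (cases "x \<in> V")
      case True
      \<comment> \<open>On the overlap \<open>cech_cochain\<close> is zero by definition, while the
        coboundary of \<open>k\<close> is \<open>g y - g x\<close>, which is zero near
        \<open>x\<close>.\<close>
      with x have "\<forall>\<^sub>F y in nhdsin X x. g y = g x \<and> y \<in> V"
        using assms(3)[of x] eventually_nhdsin_openin[OF assms(1), of x]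
        by (simp add: eventually_conj)
      then show ?thesis
        by (rule eventually_mono)
          (use True in \<open>auto simp: cech_cochain_def coboundary_Cons coboundary_Nil k_def\<close>)
    qed (simp add: cech_cochain_def k_def)
  qed
  ultimately show ?thesis
    unfolding cech_class_def
    by (intro CollectI exI[of _ "\<lambda>_. 0"] exI[of _ k]) (auto simp: k_def)
qed

lemma null_sections_Un:
  "f \<in> null_sections X p V \<Longrightarrow> f \<in> null_sections X p W \<Longrightarrow> f \<in> null_sections X p (V \<union> W)"
  by (auto simp: null_sections_def)

lemma cech_class_cocycles:
  assumes "openin X V" "openin X W" "V \<union> W = topspace X" "c \<in> cech_class X V W g"
  shows "c \<in> cocycles X 1"
proof -
  have *: "coboundary c \<in> null_sections X (Suc 1) S"
    if "openin X S" "(\<lambda>xs. c xs - coboundary h xs) \<in> null_sections X 1 S" for S h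
  proof -
    have "coboundary (\<lambda>xs. c xs - coboundary h xs) = coboundary c"
      by (simp add: fun_eq_iff coboundary_diff coboundary_coboundary)
    then show ?thesis
      using coboundary_null_sections[OF that] by simp
  qed
  show ?thesis
    using null_sections_Un[of "coboundary c" X "Suc 1" V W] *[OF assms(1)] *[OF assms(2)] assms(3,4)
    by (auto simp: cocycles_def cech_class_def)
qed

text \<open>Two choices of \<open>hV\<close>, \<open>hW\<close> for the same \<open>g\<close> differ
  by functions that agree on \<open>V \<inter> W\<close>. These glue to one global cochain, whose
  coboundary is the difference of the cocycles up to a null section.\<close>

lemma cech_class_diff:
  assumes "openin X V" "openin X W" "V \<union> W = topspace X"
    and "c \<in> cech_class X V W g" "c' \<in> cech_class X V W g"
  shows "(\<lambda>xs. c xs - c' xs) \<in> coboundaries X 1"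
proof -
  obtain hV hW where h: "\<And>x. x \<in> V \<inter> W \<Longrightarrow> g x = hW [x] - hV [x]"
    "(\<lambda>xs. c xs - coboundary hV xs) \<in> null_sections X 1 V"
    "(\<lambda>xs. c xs - coboundary hW xs) \<in> null_sections X 1 W"
    using assms(4) by (auto simp: cech_class_def)
  obtain hV' hW' where h': "\<And>x. x \<in> V \<inter> W \<Longrightarrow> g x = hW' [x] - hV' [x]"
    "(\<lambda>xs. c' xs - coboundary hV' xs) \<in> null_sections X 1 V"
    "(\<lambda>xs. c' xs - coboundary hW' xs) \<in> null_sections X 1 W"
    using assms(5) by (auto simp: cech_class_def)
  define k where "k ys = (if hd ys \<in> V then hV ys - hV' ys else hW ys - hW' ys)" for ys
  have kV: "k [x] = hV [x] - hV' [x]" if "x \<in> V" for x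
    using that by (simp add: k_def)
  have kW: "k [x] = hW [x] - hW' [x]" if "x \<in> W" for x
    using that h(1)[of x] h'(1)[of x]
    by (auto simp: k_def algebra_simps)
  have *: "(\<lambda>xs. c xs - c' xs - coboundary k xs) \<in> null_sections X 1 S"
    if "openin X S" "\<And>x. x \<in> S \<Longrightarrow> k [x] = l [x] - l' [x]"
      "(\<lambda>xs. c xs - coboundary l xs) \<in> null_sections X 1 S"
      "(\<lambda>xs. c' xs - coboundary l' xs) \<in> null_sections X 1 S" for S l l'
    unfolding null_sections_1
  proof
    fix x assume x: "x \<in> S"
    have "\<forall>\<^sub>F y in nhdsin X x. c [x, y] - coboundary l [x, y] = 0"
      "\<forall>\<^sub>F y in nhdsin X x. c' [x, y] - coboundary l' [x, y] = 0"
      "\<forall>\<^sub>F y in nhdsin X x. y \<in> S"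
      using that(3,4) x eventually_nhdsin_openin[OF that(1)] unfolding null_sections_1 by auto
    then show "\<forall>\<^sub>F y in nhdsin X x. c [x, y] - c' [x, y] - coboundary k [x, y] = 0"
      by eventually_elim (use x that(2) in \<open>auto simp: coboundary_Cons coboundary_Nil\<close>)
  qed
  have "(\<lambda>xs. c xs - c' xs - coboundary k xs) \<in> null_sections X 1 (V \<union> W)"
    by (intro null_sections_Un *[OF assms(1) kV h(2) h'(2)] *[OF assms(2) kW h(3) h'(3)])
  then show ?thesis
    using assms(3) by auto
qed

text \<open>Adding the same global cochain to \<open>hV\<close> and \<open>hW\<close> keeps their
  difference equal to \<open>g\<close>.\<close>

lemma cech_class_closed:
  assumes "V \<subseteq> topspace X" "W \<subseteq> topspace X"
    and "c \<in> cech_class X V W g" "(\<lambda>xs. c' xs - c xs) \<in> coboundaries X 1"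
  shows "c' \<in> cech_class X V W g"
proof -
  obtain hV hW where h: "\<And>x. x \<in> V \<inter> W \<Longrightarrow> g x = hW [x] - hV [x]"
    "(\<lambda>xs. c xs - coboundary hV xs) \<in> null_sections X 1 V"
    "(\<lambda>xs. c xs - coboundary hW xs) \<in> null_sections X 1 W"
    using assms(3) by (auto simp: cech_class_def)
  obtain k where k: "(\<lambda>xs. c' xs - c xs - coboundary k xs) \<in> null_sections X 1 (topspace X)"
    using assms(4) by auto
  \<comment> \<open>The sum of \<open>l\<close> and \<open>k\<close> is written as a difference with
    the scalar \<open>- 1\<close> to match \<open>coboundary_diff\<close> and
    \<open>coboundary_scale\<close>.\<close>
  have *: "(\<lambda>xs. c' xs - coboundary (\<lambda>ys. l ys - (- 1) * k ys) xs) \<in> null_sections X 1 S"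
    if "S \<subseteq> topspace X" "(\<lambda>xs. c xs - coboundary l xs) \<in> null_sections X 1 S" for S l
  proof -
    have "(\<lambda>xs. c' xs - c xs - coboundary k xs) \<in> null_sections X 1 S"
      using k that(1) by (auto simp: null_sections_def)
    from null_sections_add[OF this that(2)] show ?thesis
      by (simp add: coboundary_diff coboundary_scale algebra_simps
          del: mult_minus1 mult_minus_left) (simp add: algebra_simps)
  qed
  have "\<forall>x\<in>V \<inter> W. g x = (hW [x] - (- 1) * k [x]) - (hV [x] - (- 1) * k [x])"
    by (simp add: h(1))
  then show ?thesis
    unfolding cech_class_def using *[OF assms(1) h(2)] *[OF assms(2) h(3)]
    by (intro CollectI exI[of _ "\<lambda>ys. hV ys - (- 1) * k ys"]
        exI[of _ "\<lambda>ys. hW ys - (- 1) * k ys"] conjI)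
qed

lemma cech_class_eq_cohomology_class:
  assumes "openin X V" "openin X W" "V \<union> W = topspace X" "c \<in> cech_class X V W g"
  shows "cech_class X V W g = cohomology_class X 1 c"
  using cech_class_diff[OF assms(1-3) _ assms(4)]
    cech_class_closed[OF _ _ assms(4)] openin_subset[OF assms(1)] openin_subset[OF assms(2)]
  by (auto simp only: mem_cohomology_class)

section \<open>Avoiding finite sets in products of alephs\<close>

lemma has_card_aleph_infinite: "has_card_aleph k A \<Longrightarrow> infinite A"
proof (induction k arbitrary: A)
  case 0
  then have "natLeq \<le>o |A|"
    using ordIso_iff_ordLeq by auto
  then show ?case
    using infinite_iff_natLeq_ordLeq by blast
next
  case (Suc k)
  then obtain B :: "'a set" where B: "has_card_aleph k B" "|A| =o cardSuc |B|"
    by auto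
  have "|B| \<le>o |A|"
    using ordLeq_ordIso_trans[OF cardSuc_ordLeq[OF card_of_Card_order] ordIso_symmetric[OF B(2)]] .
  then show ?case
    using Suc.IH[OF B(1)] card_of_ordLeq_finite by blast
qed

text \<open>The recursion picks a witness for each predecessor cardinal, possibly in different
  types; invariance of \<open>cardSuc\<close> under bijections makes the choice immaterial.\<close>

lemma has_card_aleph_ordIso:
  fixes A :: "'a set" and B :: "'b set"
  shows "has_card_aleph k A \<Longrightarrow> has_card_aleph k B \<Longrightarrow> |A| =o |B|"
proof (induction k arbitrary: A B)
  case 0
  then have "|A| =o natLeq" "natLeq =o |B|"
    by (simp_all add: ordIso_symmetric)
  then show ?case
    by (rule ordIso_transitive)
next
  case (Suc k)
  then obtain A' :: "'a set" and B' :: "'b set" where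
    A: "has_card_aleph k A'" "|A| =o cardSuc |A'|" and B: "has_card_aleph k B'" "|B| =o cardSuc |B'|"
    by auto
  have "cardSuc |A'| =o cardSuc |B'|"
    by (rule cardSuc_invar_ordIso[OF card_of_Card_order card_of_Card_order, THEN iffD2])
      (rule Suc.IH[OF A(1) B(1)])
  then show ?case
    by (rule ordIso_transitive[OF A(2) ordIso_transitive[OF _ ordIso_symmetric[OF B(2)]]])
qed

lemma has_card_aleph_Suc_ordLess:
  fixes A :: "'a set" and B :: "'b set"
  assumes "has_card_aleph k A" "has_card_aleph (Suc k) B"
  shows "|A| <o |B|"
proof -
  obtain C :: "'b set" where C: "has_card_aleph k C" "|B| =o cardSuc |C|"
    using assms by auto
  have "|A| =o |C|"
    by (rule has_card_aleph_ordIso[OF assms(1) C(1)])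
  also have "|C| <o cardSuc |C|"
    by (rule cardSuc_greater[OF card_of_Card_order])
  also have "cardSuc |C| =o |B|"
    by (rule ordIso_symmetric[OF C(2)])
  finally show ?thesis .
qed

lemma has_card_aleph_mono:
  assumes "i \<le> j" "\<And>k. i \<le> k \<Longrightarrow> k \<le> j \<Longrightarrow> has_card_aleph k (A k)"
  shows "|A i| \<le>o |A j|"
  using assms
proof (induction j rule: dec_induct)
  case (step j)
  then have "|A i| \<le>o |A j|" "|A j| <o |A (Suc j)|"
    using has_card_aleph_Suc_ordLess[of j "A j" "A (Suc j)"] step.prems[of j] step.prems[of "Suc j"]
    by (simp_all del: has_card_aleph.simps)
  then show ?case
    using ordLeq_ordLess_trans ordLess_imp_ordLeq by blast
qed (simp add: card_of_mono1)

lemma card_of_finite_ordLess: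
  "finite D \<Longrightarrow> infinite C \<Longrightarrow> |D| <o |C|"
  using finite_ordLess_infinite[OF card_of_Well_order card_of_Well_order] by (simp add: Field_card_of)

lemma card_of_PiE_ordLeq_infinite:
  assumes "finite I" "infinite C" "\<And>i. i \<in> I \<Longrightarrow> |B i| \<le>o |C|"
  shows "|PiE I B| \<le>o |C|"
  using assms(1,3)
proof (induction I)
  case empty
  then show ?case
    using assms(2) by (simp add: ordLess_imp_ordLeq card_of_finite_ordLess)
next
  case (insert i I)
  have "|PiE (insert i I) B| \<le>o |B i \<times> PiE I B|"
    unfolding PiE_insert_eq by (rule card_of_image)
  also have "|B i \<times> PiE I B| \<le>o |C|"
    using assms(2) insert.IH insert.prems
    by (intro card_of_Times_ordLeq_infinite_Field card_of_Card_order) (simp_all add: Field_card_of)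
  finally show ?case .
qed

lemma card_of_Un_ordIso_infinite:
  assumes "infinite (E \<union> F)" "|E| =o |F|"
  shows "|E| =o |E \<union> F|"
proof -
  have "infinite E"
    using assms card_of_ordIso_finite[OF assms(2)] by auto
  moreover have "|F| \<le>o |E|"
    using assms(2) ordIso_symmetric ordIso_iff_ordLeq by blast
  ultimately have "|E \<union> F| \<le>o |E|"
    by (intro card_of_Un_ordLeq_infinite_Field card_of_Card_order)
      (simp_all add: Field_card_of card_of_mono1)
  then show ?thesis
    by (simp add: ordIso_iff_ordLeq card_of_mono1)
qed

lemma card_of_ordLess_notin:
  assumes "|N| <o |A|" "|E| =o |A|"
  obtains x where "x \<in> E" "x \<notin> N"
proof -
  have "\<not> E \<subseteq> N"
    using assms card_of_mono1[of E N] ordIso_ordLeq_trans[of "|A|" "|E|" "|N|"]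
      ordIso_symmetric not_ordLess_ordLeq by blast
  then show thesis
    using that by blast
qed

text \<open>If \<open>j = 0\<close>, this is a finite union of finite sets. If
  \<open>j = Suc i\<close>, the coordinates below \<open>j\<close> have at most aleph
  \<open>i\<close> values and the others finitely many, so the union has size at most aleph
  \<open>i\<close>.\<close>

lemma card_of_UN_PiE_ordLess:
  fixes A :: "nat \<Rightarrow> 'a set" and B :: "(nat \<Rightarrow> 'a) \<Rightarrow> 'a set"
  assumes aleph: "\<And>k. k \<le> m \<Longrightarrow> has_card_aleph k (A k)" and "j \<le> m"
    and fin: "\<And>k. j \<le> k \<Longrightarrow> k \<le> m \<Longrightarrow> finite (C k)" "\<And>z. finite (B z)"
  shows "|\<Union>z \<in> PiE {..m} (\<lambda>k. if k < j then A k else C k). B z| <o |A j|"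
proof (cases j)
  case 0
  then have "finite (\<Union>z \<in> PiE {..m} (\<lambda>k. if k < j then A k else C k). B z)"
    using fin by (intro finite_UN_I finite_PiE) auto
  then show ?thesis
    using has_card_aleph_infinite[OF aleph[OF \<open>j \<le> m\<close>]] by (rule card_of_finite_ordLess)
next
  case (Suc i)
  then have i: "has_card_aleph i (A i)"
    using aleph \<open>j \<le> m\<close> by simp
  have small: "|D| \<le>o |A i|" if "finite D" for D :: "'a set"
    using that has_card_aleph_infinite[OF i] by (simp add: card_of_finite_ordLess ordLess_imp_ordLeq)
  have "|PiE {..m} (\<lambda>k. if k < j then A k else C k)| \<le>o |A i|"
  proof (rule card_of_PiE_ordLeq_infinite)
    fix k assume "k \<in> {..m}"
    then show "|if k < j then A k else C k| \<le>o |A i|"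
      using has_card_aleph_mono[of k i A] aleph small fin(1)[of k] Suc \<open>j \<le> m\<close> by auto
  qed (simp_all add: has_card_aleph_infinite[OF i])
  then have "|\<Union>z \<in> PiE {..m} (\<lambda>k. if k < j then A k else C k). B z| \<le>o |A i|"
    using has_card_aleph_infinite[OF i] fin(2) small
    by (intro card_of_UNION_ordLeq_infinite) auto
  moreover have "|A i| <o |A j|"
    using aleph[OF \<open>j \<le> m\<close>] unfolding Suc by (rule has_card_aleph_Suc_ordLess[OF i])
  ultimately show ?thesis
    by (rule ordLeq_ordLess_trans)
qed

text \<open>The pairs are chosen from the largest cardinal downwards: for coordinate \<open>j\<close>, fewer than
  \<open>\<aleph>\<^sub>j\<close> points of the remaining coordinates matter, so their finite sets do not cover \<open>E j\<close> or \<open>F j\<close>.\<close>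

lemma good_box:
  fixes A E F :: "nat \<Rightarrow> 'a set" and B :: "nat \<Rightarrow> (nat \<Rightarrow> 'a) \<Rightarrow> 'a set"
  assumes aleph: "\<And>k. k \<le> m \<Longrightarrow> has_card_aleph k (A k)"
    and EF: "\<And>k. k \<le> m \<Longrightarrow> A k = E k \<union> F k \<and> |E k| =o |F k|"
    and fin: "\<And>k z. finite (B k z)" and indep: "\<And>k z w. B k (z(k := w)) = B k z"
  obtains a b where "\<forall>k\<le>m. a k \<in> E k \<and> b k \<in> F k"
    "\<forall>z\<in>PiE {..m} (\<lambda>k. {a k, b k}). \<forall>k\<le>m. z k \<notin> B k z"
proof -
  \<comment> \<open>Coordinates below \<open>j\<close> stay arbitrary in \<open>A\<close>, so that
    choices made later at smaller indices cannot spoil the conditions already secured.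
    \<open>P (Suc m)\<close> is vacuous and \<open>P 0\<close> is the claim.\<close>
  define P where "P j \<longleftrightarrow> (\<exists>a b. (\<forall>k. j \<le> k \<and> k \<le> m \<longrightarrow> a k \<in> E k \<and> b k \<in> F k) \<and>
    (\<forall>z k. z \<in> PiE {..m} (\<lambda>k. if k < j then A k else {a k, b k}) \<longrightarrow> j \<le> k \<longrightarrow> k \<le> m \<longrightarrow>
      z k \<notin> B k z))" for j
  have "P 0"
  proof (rule inc_induct[of 0 "Suc m"])
    fix j assume "j < Suc m" and "P (Suc j)"
    then have j: "j \<le> m"
      by simp
    obtain a b where ab: "\<And>k. Suc j \<le> k \<Longrightarrow> k \<le> m \<Longrightarrow> a k \<in> E k \<and> b k \<in> F k"
      "\<And>z k. z \<in> PiE {..m} (\<lambda>k. if k < Suc j then A k else {a k, b k}) \<Longrightarrow> Suc j \<le> k \<Longrightarrow> k \<le> m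
        \<Longrightarrow> z k \<notin> B k z"
      using \<open>P (Suc j)\<close> unfolding P_def by blast
    \<comment> \<open>As \<open>B j\<close> ignores coordinate \<open>j\<close>, a single
      placeholder value there represents all of them.\<close>
    define C where "C k = (if k = j then {undefined} else {a k, b k})" for k
    define N where "N = (\<Union>z \<in> PiE {..m} (\<lambda>k. if k < j then A k else C k). B j z)"
    have N: "|N| <o |A j|"
      unfolding N_def using aleph j fin
      by (intro card_of_UN_PiE_ordLess[where m = m]) (auto simp: C_def)
    have "infinite (E j \<union> F j)"
      using has_card_aleph_infinite[OF aleph[OF j]] EF[OF j] by simp
    then have "|E j| =o |A j|" "|F j| =o |A j|"
      using card_of_Un_ordIso_infinite[of "E j" "F j"] card_of_Un_ordIso_infinite[of "F j" "E j"]
        EF[OF j] ordIso_symmetric by (auto simp: Un_commute)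
    then obtain x y where x: "x \<in> E j" "x \<notin> N" and y: "y \<in> F j" "y \<notin> N"
      using card_of_ordLess_notin[OF N] by metis
    have "z k \<notin> B k z"
      if z: "z \<in> PiE {..m} (\<lambda>k. if k < j then A k else {(a(j := x)) k, (b(j := y)) k})"
        and k: "j \<le> k" "k \<le> m" for z k
    proof -
      have zl: "z l \<in> (if l < j then A l else if l = j then {x, y} else {a l, b l})" if "l \<le> m" for l
        using PiE_mem[OF z, of l] that by (auto split: if_splits)
      have ext: "z \<in> extensional {..m}"
        using z by (simp add: PiE_iff)
      show ?thesis
      proof (cases "k = j")
        case True
        have "(z(j := undefined)) l \<in> (if l < j then A l else C l)" if "l \<le> m" for l
          using zl[OF that] by (auto simp: C_def split: if_splits)
        then have "z(j := undefined) \<in> PiE {..m} (\<lambda>k. if k < j then A k else C k)"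
          using ext j unfolding PiE_iff extensional_def by auto
        then have "B j (z(j := undefined)) \<subseteq> N"
          unfolding N_def by blast
        then show ?thesis
          using True zl[OF j] x y indep[of j z undefined] by auto
      next
        case False
        \<comment> \<open>The new values \<open>x\<close> and \<open>y\<close> lie in
          \<open>A j\<close>, so the condition secured for arbitrary coordinate \<open>j\<close>
          applies.\<close>
        have "z l \<in> (if l < Suc j then A l else {a l, b l})" if "l \<le> m" for l
          using zl[OF that] EF[OF j] x y by (auto split: if_splits)
        then have "z \<in> PiE {..m} (\<lambda>k. if k < Suc j then A k else {a k, b k})"
          using ext unfolding PiE_iff by simp
        then show ?thesis
          using ab(2) False k by simp
      qed
    qed
    moreover have "(a(j := x)) k \<in> E k \<and> (b(j := y)) k \<in> F k" if "j \<le> k" "k \<le> m" for k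
      using that ab(1)[of k] x y by auto
    ultimately show "P j"
      unfolding P_def by (intro exI[of _ "a(j := x)"] exI[of _ "b(j := y)"]) blast
  next
    have "\<not> (Suc m \<le> k \<and> k \<le> m)" for k
      by simp
    then show "P (Suc m)"
      unfolding P_def by blast
  qed simp
  then obtain a b where "\<forall>k. 0 \<le> k \<and> k \<le> m \<longrightarrow> a k \<in> E k \<and> b k \<in> F k"
    "\<forall>z k. z \<in> PiE {..m} (\<lambda>k. if k < 0 then A k else {a k, b k}) \<longrightarrow> 0 \<le> k \<longrightarrow> k \<le> m \<longrightarrow>
      z k \<notin> B k z"
    unfolding P_def by blast
  then show thesis
    by (intro that[of a b]) auto
qed

text \<open>The orbits of an involution without fixed points are pairs with equal values, which
  cancel in characteristic 2.\<close>

lemma sum_involution_bit: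
  fixes \<phi> :: "'b \<Rightarrow> bit"
  assumes "finite S"
    and "\<And>x. x \<in> S \<Longrightarrow> g x \<in> S" "\<And>x. x \<in> S \<Longrightarrow> g (g x) = x" "\<And>x. x \<in> S \<Longrightarrow> g x \<noteq> x"
    and "\<And>x. x \<in> S \<Longrightarrow> \<phi> (g x) = \<phi> x"
  shows "sum \<phi> S = 0"
  using assms
proof (induction S rule: finite_psubset_induct)
  case (psubset S)
  show ?case
  proof (cases "S = {}")
    case False
    then obtain x where x: "x \<in> S"
      by blast
    define S' where "S' = S - {x, g x}"
    have "sum \<phi> S' = 0"
    proof (rule psubset.IH)
      show "S' \<subset> S"
        using x by (auto simp: S'_def)
      show "g y \<in> S'" if "y \<in> S'" for y
        using that psubset.prems(1,2) x unfolding S'_def by (metis DiffE DiffI insert_iff empty_iff)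
    qed (use psubset.prems in \<open>auto simp: S'_def\<close>)
    moreover have "sum \<phi> S = \<phi> x + \<phi> (g x) + sum \<phi> S'"
    proof -
      have "S = insert x (insert (g x) S')" "x \<notin> insert (g x) S'" "g x \<notin> S'" "finite S'"
        using x psubset.prems(1,3)[of x] psubset.hyps by (auto simp: S'_def)
      then show ?thesis
        by (metis (no_types) add.assoc finite_insert sum.insert)
    qed
    ultimately show ?thesis
      using psubset.prems(4)[OF x] by simp
  qed simp
qed

section \<open>The punctured spaces and flags of points\<close>

lemma topspace_punctured:
  "topspace (punctured A B) = insert None (Some ` A) \<times> insert None (Some ` B) - {(None, None)}"
  by (auto simp: punctured_def Let_def)

lemma continuous_map_fst_punctured:
  "continuous_map (punctured A B) (Alexandroff_compactification (discrete_topology A)) fst"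
  unfolding punctured_def Let_def by (intro continuous_map_from_subtopology continuous_map_fst)

lemma continuous_map_snd_punctured:
  "continuous_map (punctured A B) (Alexandroff_compactification (discrete_topology B)) snd"
  unfolding punctured_def Let_def by (intro continuous_map_from_subtopology continuous_map_snd)

lemma openin_punctured_fst:
  assumes "C \<subseteq> A"
  shows "openin (punctured A B) {z \<in> topspace (punctured A B). fst z \<in> Some ` C}"
  using assms
  by (intro openin_continuous_map_preimage[OF continuous_map_fst_punctured]) simp

lemma openin_punctured_snd:
  assumes "C \<subseteq> B"
  shows "openin (punctured A B) {z \<in> topspace (punctured A B). snd z \<in> Some ` C}"
  using assms
  by (intro openin_continuous_map_preimage[OF continuous_map_snd_punctured]) simp

definition finite_fst :: "'a set \<Rightarrow> 'b set \<Rightarrow> ('a option \<times> 'b option) set" where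
  "finite_fst A B = {z \<in> topspace (punctured A B). fst z \<noteq> None}"

definition finite_snd :: "'a set \<Rightarrow> 'b set \<Rightarrow> ('a option \<times> 'b option) set" where
  "finite_snd A B = {z \<in> topspace (punctured A B). snd z \<noteq> None}"

lemma openin_finite_fst: "openin (punctured A B) (finite_fst A B)"
proof -
  have "finite_fst A B = {z \<in> topspace (punctured A B). fst z \<in> Some ` A}"
    by (auto simp: finite_fst_def topspace_punctured)
  then show ?thesis
    using openin_punctured_fst[of A A B] by simp
qed

lemma openin_finite_snd: "openin (punctured A B) (finite_snd A B)"
proof -
  have "finite_snd A B = {z \<in> topspace (punctured A B). snd z \<in> Some ` B}"
    by (auto simp: finite_snd_def topspace_punctured)
  then show ?thesis
    using openin_punctured_snd[of B B A] by simp
qed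

lemma finite_fst_Un_finite_snd: "finite_fst A B \<union> finite_snd A B = topspace (punctured A B)"
  by (auto simp: finite_fst_def finite_snd_def topspace_punctured)

text \<open>Points of the overlap are isolated, so every function on it is locally constant and
  hence a Cech cocycle.\<close>

lemma openin_punctured_singleton:
  assumes "z \<in> finite_fst A B \<inter> finite_snd A B"
  shows "openin (punctured A B) {z}"
proof -
  obtain x y where z: "z = (Some x, Some y)" "x \<in> A" "y \<in> B"
    using assms by (auto simp: finite_fst_def finite_snd_def topspace_punctured)
  have "{z} = {z \<in> topspace (punctured A B). fst z \<in> Some ` {x}} \<inter>
      {z \<in> topspace (punctured A B). snd z \<in> Some ` {y}}"
    using z by (auto simp: topspace_punctured)
  then show ?thesis
    using z openin_punctured_fst[of "{x}" A B] openin_punctured_snd[of "{y}" B A] by auto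
qed

lemma cech_cochain_in_represented_class:
  "cech_cochain (finite_fst A B) (\<lambda>z. g (the (fst z)) (the (snd z))) \<in> represented_class A B g"
  unfolding represented_class_def finite_fst_def[symmetric] finite_snd_def[symmetric]
proof (rule cech_cochain_in_class[OF openin_finite_fst openin_finite_snd])
  fix x assume "x \<in> finite_fst A B \<inter> finite_snd A B"
  then have "\<forall>\<^sub>F y in nhdsin (punctured A B) x. y \<in> {x}"
    by (intro eventually_nhdsin_openin openin_punctured_singleton) auto
  then show "\<forall>\<^sub>F y in nhdsin (punctured A B) x.
      g (the (fst y)) (the (snd y)) = g (the (fst x)) (the (snd x))"
    by (rule eventually_mono) auto
qed

lemma represented_class_cocycles:
  assumes "c \<in> represented_class A B g"
  shows "c \<in> cocycles (punctured A B) 1"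
  using assms
  unfolding represented_class_def finite_fst_def[symmetric] finite_snd_def[symmetric]
  by (rule cech_class_cocycles[OF openin_finite_fst openin_finite_snd finite_fst_Un_finite_snd])

lemma represented_class_eq_cohomology_class:
  assumes "c \<in> represented_class A B g"
  shows "represented_class A B g = cohomology_class (punctured A B) 1 c"
  using assms
  unfolding represented_class_def finite_fst_def[symmetric] finite_snd_def[symmetric]
  by (rule cech_class_eq_cohomology_class[OF openin_finite_fst openin_finite_snd
        finite_fst_Un_finite_snd])

section \<open>Points of the product with some factors at infinity\<close>

abbreviation punctured_product ::
    "nat \<Rightarrow> (nat \<Rightarrow> 'a set) \<Rightarrow> (nat \<Rightarrow> 'a option \<times> 'a option) topology" where
  "punctured_product n A \<equiv> product_topology (\<lambda>i. punctured (A (2 * i)) (A (2 * i + 1))) {0..n}"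

text \<open>The components of the point \<open>z\<close> outside \<open>S\<close> are moved to infinity, in the first variable for
  indices in \<open>T\<close> and in the second one otherwise; \<open>free_coord T i\<close> is the variable then forgotten.\<close>

definition flag_point ::
    "nat \<Rightarrow> nat set \<Rightarrow> nat set \<Rightarrow> (nat \<Rightarrow> 'a) \<Rightarrow> nat \<Rightarrow> 'a option \<times> 'a option" where
  "flag_point n S T z = (\<lambda>i\<in>{0..n}.
     if i \<in> S then (Some (z (2 * i)), Some (z (2 * i + 1)))
     else if i \<in> T then (None, Some (z (2 * i + 1)))
     else (Some (z (2 * i)), None))"

definition free_coord :: "nat set \<Rightarrow> nat \<Rightarrow> nat" where
  "free_coord T i = (if i \<in> T then 2 * i else 2 * i + 1)"

lemma free_coord_le: "i \<le> n \<Longrightarrow> free_coord T i \<le> 2 * n + 1"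
  by (simp add: free_coord_def)

text \<open>\<open>T\<close> is read only at factors that are still at infinity.\<close>

lemma flag_point_cong:
  "(\<And>i. i \<notin> S \<Longrightarrow> i \<in> T \<longleftrightarrow> i \<in> T') \<Longrightarrow> flag_point n S T z = flag_point n S T' z"
  by (auto simp: flag_point_def fun_eq_iff restrict_def)

text \<open>While factor \<open>i\<close> is at infinity, its coordinate
  \<open>free_coord T i\<close> is hidden. This gives both the independence of the exceptional sets
  and the cancellation at the last point of a flag.\<close>

lemma flag_point_fun_upd:
  assumes "i \<notin> S"
  shows "flag_point n S T (z(free_coord T i := w)) = flag_point n S T z"
proof -
  have "2 * l \<noteq> 2 * i + 1" "2 * l + 1 \<noteq> 2 * i" for l :: nat
    by presburger+
  then show ?thesis
    using assms by (fastforce simp: flag_point_def fun_eq_iff restrict_def free_coord_def)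
qed

lemma flag_point_topspace:
  assumes "\<And>k. k \<le> 2 * n + 1 \<Longrightarrow> z k \<in> A k"
  shows "flag_point n S T z \<in> topspace (punctured_product n A)"
  using assms by (auto simp: flag_point_def topspace_punctured)

text \<open>Letting the hidden variable run through the one-point compactification of
  \<open>A k\<close> gives a continuous map \<open>\<psi>\<close> into the product that sends
  infinity to the given point. The preimage of \<open>N\<close> is an open neighbourhood of
  infinity, hence cofinite.\<close>

lemma finite_flag_point_insert_notin:
  assumes z: "\<And>k. k \<le> 2 * n + 1 \<Longrightarrow> z k \<in> A k" and i: "i \<le> n" "i \<notin> S"
    and N: "openin (punctured_product n A) N" "flag_point n S T z \<in> N"
  defines "k \<equiv> free_coord T i"
  shows "finite {x \<in> A k. flag_point n (insert i S) T (z(k := x)) \<notin> N}"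
proof -
  define X where "X = Alexandroff_compactification (discrete_topology (A k))"
  define \<psi> where "\<psi> w = (\<lambda>l\<in>{0..n}. if l = i
      then if i \<in> T then (w, Some (z (2 * i + 1))) else (Some (z (2 * i)), w)
      else flag_point n S T z l)" for w
  have ne: "2 * l \<noteq> 2 * i + 1" "2 * l + 1 \<noteq> 2 * i" for l :: nat
    by presburger+
  have None: "\<psi> None = flag_point n S T z"
    using i by (auto simp: \<psi>_def flag_point_def fun_eq_iff)
  have Some: "\<psi> (Some x) = flag_point n (insert i S) T (z(k := x))" for x
    using i ne by (auto simp: \<psi>_def flag_point_def fun_eq_iff k_def free_coord_def restrict_def)
  have "continuous_map X (punctured_product n A) \<psi>"
  proof (rule continuous_map_coordinatewise_then_product)
    fix l assume l: "l \<in> {0..n}"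
    show "continuous_map X (punctured (A (2 * l)) (A (2 * l + 1))) (\<lambda>w. \<psi> w l)"
    proof (cases "l = i")
      case False
      have "flag_point n S T z l \<in> topspace (punctured (A (2 * l)) (A (2 * l + 1)))"
        using flag_point_topspace[of n z A S T, OF z] l by auto
      then show ?thesis
        using False l by (simp add: \<psi>_def)
    next
      case True
      have "continuous_map X X (\<lambda>w. w)"
        by simp
      moreover have "z (2 * i) \<in> A (2 * i)" "z (2 * i + 1) \<in> A (2 * i + 1)"
        using z i by auto
      ultimately show ?thesis
        unfolding punctured_def Let_def using True i
        by (auto simp: \<psi>_def X_def k_def free_coord_def
            intro!: continuous_map_into_subtopology continuous_map_pairedI)
    qed
  qed (simp add: \<psi>_def)
  then have "openin X {w \<in> topspace X. \<psi> w \<in> N}"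
    using N(1) by (rule openin_continuous_map_preimage)
  moreover have "None \<in> {w \<in> topspace X. \<psi> w \<in> N}"
    using N(2) None by (simp add: X_def)
  ultimately obtain C where C: "compactin (discrete_topology (A k)) C"
    "{w \<in> topspace X. \<psi> w \<in> N} = insert None (Some ` (A k - C))"
    unfolding X_def openin_Alexandroff_compactification by auto
  have "x \<in> C" if "x \<in> A k" "\<psi> (Some x) \<notin> N" for x
  proof (rule ccontr)
    assume "x \<notin> C"
    then have "Some x \<in> {w \<in> topspace X. \<psi> w \<in> N}"
      using that(1) unfolding C(2) by simp
    then show False
      using that(2) by simp
  qed
  then have "{x \<in> A k. flag_point n (insert i S) T (z(k := x)) \<notin> N} \<subseteq> C"
    by (auto simp: Some)
  moreover have "finite C"
    using C(1) by (simp add: compactin_discrete_topology)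
  ultimately show ?thesis
    by (rule finite_subset)
qed

text \<open>One step of the recursion of \<open>vanishes_at\<close> along a flag: the neighbourhood
  it provides is left by only finitely many values of the returning variable.\<close>

lemma finite_not_vanishes_at_flag_point:
  assumes "\<And>k. k \<le> 2 * n + 1 \<Longrightarrow> z k \<in> A k" "i \<le> n" "i \<notin> S"
    and "vanishes_at (punctured_product n A) (Suc p) (flag_point n S T z) \<phi>"
  defines "k \<equiv> free_coord T i"
  shows "finite {x \<in> A k. \<not> vanishes_at (punctured_product n A) p
    (flag_point n (insert i S) T (z(k := x))) (\<lambda>ys. \<phi> (flag_point n S T z # ys))}"
proof -
  have "\<forall>\<^sub>F y in nhdsin (punctured_product n A) (flag_point n S T z).
      vanishes_at (punctured_product n A) p y (\<lambda>ys. \<phi> (flag_point n S T z # ys))"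
    using assms(4) by simp
  then have "\<exists>N. openin (punctured_product n A) N \<and> flag_point n S T z \<in> N \<and>
      (\<forall>y\<in>N. vanishes_at (punctured_product n A) p y (\<lambda>ys. \<phi> (flag_point n S T z # ys)))"
    by (rule eventually_nhdsinD) (rule flag_point_topspace[OF assms(1)])
  then obtain N where N: "openin (punctured_product n A) N" "flag_point n S T z \<in> N"
    "\<forall>y\<in>N. vanishes_at (punctured_product n A) p y (\<lambda>ys. \<phi> (flag_point n S T z # ys))"
    by (elim exE conjE)
  show ?thesis
    unfolding k_def
    by (rule finite_subset[OF _ finite_flag_point_insert_notin[OF assms(1-3) N(1,2)]])
      (use N(3) in auto)
qed

section \<open>Flags and their exceptional values\<close>

definition flag ::
    "nat \<Rightarrow> nat set \<Rightarrow> (nat \<Rightarrow> nat) \<Rightarrow> (nat \<Rightarrow> 'a) \<Rightarrow> (nat \<Rightarrow> 'a option \<times> 'a option) list" where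
  "flag n T \<sigma> z = map (\<lambda>j. flag_point n (\<sigma> ` {..<j}) T z) [0..<n + 2]"

lemma length_flag: "length (flag n T \<sigma> z) = n + 2"
  by (simp add: flag_def)

lemma nth_flag: "j < n + 2 \<Longrightarrow> flag n T \<sigma> z ! j = flag_point n (\<sigma> ` {..<j}) T z"
  by (simp add: flag_def del: upt_Suc)

lemma permutes_notin_image:
  assumes "\<sigma> permutes S" "i \<notin> J"
  shows "\<sigma> i \<notin> \<sigma> ` J"
  using permutes_inj[OF assms(1)] assms(2) by (auto dest: injD)

lemma permutes_le: "\<sigma> permutes {..n} \<Longrightarrow> i \<le> n \<Longrightarrow> \<sigma> i \<le> n" for n :: nat
  using permutes_in_image[of \<sigma> "{..n}" i] by simp

text \<open>Each step of a flag returns one variable from infinity and excludes finitely many of its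
  values, depending on the other variables only. \<open>B k z\<close> collects these over the
  finitely many triples of \<open>T\<close>, \<open>\<sigma>\<close> and a step that returns
  variable \<open>k\<close>.\<close>

lemma null_section_flag_exceptions:
  assumes null: "\<phi> \<in> null_sections (punctured_product n A) (Suc n) (topspace (punctured_product n A))"
  obtains B where "\<forall>k z. finite (B k z)" "\<forall>k z w. B k (z(k := w)) = B k z"
    "\<forall>z T \<sigma>. (\<forall>k\<le>2 * n + 1. z k \<in> A k \<and> z k \<notin> B k z) \<longrightarrow> T \<subseteq> {..n} \<longrightarrow> \<sigma> permutes {..n} \<longrightarrow>
      \<phi> (flag n T \<sigma> z) = 0"
proof -
  define U where "U = punctured_product n A"
  define pt where "pt T \<sigma> z j = flag_point n (\<sigma> ` {..<j}) T z" 
    for T and \<sigma> :: "nat \<Rightarrow> nat" and j and z :: "nat \<Rightarrow> 'a"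
  define D where "D T \<sigma> j z = {x \<in> A (free_coord T (\<sigma> j)). \<not> vanishes_at U (n - j)
      (flag_point n (insert (\<sigma> j) (\<sigma> ` {..<j})) T (z(free_coord T (\<sigma> j) := x)))
      (\<lambda>ys. \<phi> (map (pt T \<sigma> z) [0..<j] @ pt T \<sigma> z j # ys))}" for T \<sigma> j z
  define I where "I = Pow {..n} \<times> {\<sigma>. \<sigma> permutes {..n}} \<times> {..n}"
  \<comment> \<open>Infinite sets \<open>D\<close> are replaced by the empty set, so that
    \<open>B k z\<close> is finite for every \<open>z\<close>. Where \<open>B\<close> is applied
    below, finiteness of \<open>D\<close> is proved first.\<close>
  define B where "B k z = (\<Union>(T, \<sigma>, j) \<in> {(T, \<sigma>, j) \<in> I. free_coord T (\<sigma> j) = k}.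
      if finite (D T \<sigma> j z) then D T \<sigma> j z else {})" for k z
  show thesis
  proof (rule that; intro allI impI)
    have "finite I"
      unfolding I_def by (simp add: finite_permutations)
    then show "finite (B k z)" for k z
      unfolding B_def by (intro finite_UN_I) (auto intro: finite_subset[of _ I])
  next
    fix k z w
    have "D T \<sigma> j (z(k := w)) = D T \<sigma> j z"
      if "\<sigma> permutes {..n}" "free_coord T (\<sigma> j) = k" for T \<sigma> j
    proof -
      \<comment> \<open>The points up to position \<open>j\<close> precede the return of factor
        \<open>\<sigma> j\<close>, so they do not read coordinate \<open>k\<close>; in the next
        point \<open>D\<close> overwrites it by \<open>x\<close>.\<close>
      have "pt T \<sigma> (z(k := w)) l = pt T \<sigma> z l" if "l \<le> j" for l
        unfolding pt_def \<open>free_coord T (\<sigma> j) = k\<close>[symmetric]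
        using that by (intro flag_point_fun_upd permutes_notin_image[OF \<open>\<sigma> permutes {..n}\<close>]) simp
      then have pt: "map (pt T \<sigma> (z(k := w))) [0..<j] = map (pt T \<sigma> z) [0..<j]"
        "pt T \<sigma> (z(k := w)) j = pt T \<sigma> z j"
        by simp_all
      show ?thesis
        by (simp only: D_def that(2) pt fun_upd_upd)
    qed
    then show "B k (z(k := w)) = B k z"
      unfolding B_def by (intro SUP_cong refl) (clarsimp simp: I_def)
  next
    fix z T \<sigma>
    assume "\<forall>k\<le>2 * n + 1. z k \<in> A k \<and> z k \<notin> B k z" and T: "T \<subseteq> {..n}"
      and \<sigma>: "\<sigma> permutes {..n}"
    then have z: "z k \<in> A k \<and> z k \<notin> B k z" if "k \<le> 2 * n + 1" for k
      using that by blast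
    \<comment> \<open>Each step uses up one degree: vanishing at point \<open>j\<close> makes
      \<open>D T \<sigma> j z\<close> finite, hence contained in \<open>B\<close>, and
      \<open>z\<close> avoids it. At \<open>j = Suc n\<close> no degree is left, and the value
      itself is zero.\<close>
    have van: "vanishes_at U (Suc n - j) (pt T \<sigma> z j) (\<lambda>ys. \<phi> (map (pt T \<sigma> z) [0..<j] @ ys))"
      if "j \<le> Suc n" for j
      using that
    proof (induction j)
      case 0
      have "pt T \<sigma> z 0 \<in> topspace U"
        unfolding pt_def U_def using z by (intro flag_point_topspace) auto
      then show ?case
        using null by (simp add: null_sections_def U_def)
    next
      case (Suc j)
      define k where "k = free_coord T (\<sigma> j)"
      have j: "j \<le> n"
        using Suc.prems by simp
      then have k: "k \<le> 2 * n + 1"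
        unfolding k_def by (intro free_coord_le permutes_le[OF \<sigma>])
      have "vanishes_at U (Suc (n - j)) (pt T \<sigma> z j) (\<lambda>ys. \<phi> (map (pt T \<sigma> z) [0..<j] @ ys))"
        using Suc by (simp add: Suc_diff_le)
      then have "finite (D T \<sigma> j z)"
        unfolding D_def U_def pt_def[of T \<sigma> z j]
        using z by (intro finite_not_vanishes_at_flag_point permutes_le[OF \<sigma> j]
            permutes_notin_image[OF \<sigma>]) auto
      moreover have "(T, \<sigma>, j) \<in> {(T, \<sigma>, j) \<in> I. free_coord T (\<sigma> j) = k}"
        using T \<sigma> j by (simp add: I_def k_def)
      ultimately have "D T \<sigma> j z \<subseteq> B k z"
        unfolding B_def by fastforce
      then have "z k \<notin> D T \<sigma> j z"
        using z[OF k] by blast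
      then have "vanishes_at U (n - j) (flag_point n (insert (\<sigma> j) (\<sigma> ` {..<j})) T (z(k := z k)))
          (\<lambda>ys. \<phi> (map (pt T \<sigma> z) [0..<j] @ pt T \<sigma> z j # ys))"
        using z[OF k] unfolding D_def k_def by blast
      moreover have "pt T \<sigma> z (Suc j) = flag_point n (insert (\<sigma> j) (\<sigma> ` {..<j})) T z"
        by (simp add: pt_def lessThan_Suc)
      ultimately show ?case
        by simp
    qed
    show "\<phi> (flag n T \<sigma> z) = 0"
      using van[of "Suc n"] by (simp add: flag_def flip: pt_def)
  qed
qed

section \<open>Coboundaries summed over all flags\<close>

lemma coboundary_bit:
  fixes h :: "'x list \<Rightarrow> bit"
  shows "coboundary h xs = (\<Sum>i<length xs. h (take i xs @ drop (Suc i) xs))"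
proof -
  have "(- 1 :: bit) ^ i = 1" for i
    by (simp only: uminus_bit_def id_apply power_one)
  then show ?thesis
    by (simp only: coboundary_def mult_1_left)
qed

lemma flag_omit_cong:
  assumes "\<And>j. j < n + 2 \<Longrightarrow> j \<noteq> i \<Longrightarrow>
      flag_point n (\<sigma> ` {..<j}) T z = flag_point n (\<sigma>' ` {..<j}) T' z'" "i < n + 2"
  shows "take i (flag n T \<sigma> z) @ drop (Suc i) (flag n T \<sigma> z) =
    take i (flag n T' \<sigma>' z') @ drop (Suc i) (flag n T' \<sigma>' z')"
  using assms by (simp add: flag_def take_map drop_map del: upt_Suc)

text \<open>Exchanging two consecutive steps of a flag therefore changes only the point between
  them.\<close>

lemma transpose_image_lessThan:
  assumes "j \<noteq> Suc i"
  shows "Transposition.transpose i (Suc i) ` {..<j} = {..<j}"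
proof -
  have "Transposition.transpose i (Suc i) ` {..<j} \<subseteq> {..<j}"
    using assms by (auto simp: Transposition.transpose_def)
  moreover have "{..<j} \<subseteq> Transposition.transpose i (Suc i) ` {..<j}"
    using assms image_mono[OF calculation, of "Transposition.transpose i (Suc i)"]
    by (simp add: image_comp)
  ultimately show ?thesis
    by blast
qed

text \<open>The terms are grouped by the omitted position. Each group vanishes by an involution of
  \<open>S\<close> without fixed points that preserves the shortened flag.\<close>

lemma sum_flag_coboundary:
  fixes h :: "(nat \<Rightarrow> 'a option \<times> 'a option) list \<Rightarrow> bit"
  assumes ab: "\<And>k. k \<le> 2 * n + 1 \<Longrightarrow> a k \<noteq> b k"
  defines "S \<equiv> PiE {..2 * n + 1} (\<lambda>k. {a k, b k}) \<times> Pow {..n} \<times> {\<sigma>. \<sigma> permutes {..n}}"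
  shows "(\<Sum>(z, T, \<sigma>)\<in>S. coboundary h (flag n T \<sigma> z)) = 0"
proof -
  have fin: "finite S"
    unfolding S_def by (intro finite_cartesian_product finite_PiE) (simp_all add: finite_permutations)
  define om where "om i = (\<lambda>(z, T, \<sigma>). h (take i (flag n T \<sigma> z) @ drop (Suc i) (flag n T \<sigma> z)))" for i
  have sum0: "sum (om i) S = 0" if i: "i < n + 2" for i
  proof -
    consider "i = 0" | l where "i = Suc l" "l < n" | "i = Suc n"
      using i by (metis Suc_less_eq add_2_eq_Suc' less_Suc_eq not0_implies_Suc)
    then show ?thesis
    proof cases
      case 1
      \<comment> \<open>Toggling \<open>\<sigma> 0\<close> in \<open>T\<close> affects only the
        point with factor \<open>\<sigma> 0\<close> still at infinity, which is the omitted first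
        one.\<close>
      define g where "g = (\<lambda>(z :: nat \<Rightarrow> 'a, T, \<sigma> :: nat \<Rightarrow> nat).
        (z, if \<sigma> 0 \<in> T then T - {\<sigma> 0} else insert (\<sigma> 0) T, \<sigma>))"
      show ?thesis
      proof (rule sum_involution_bit[OF fin, of g])
        fix x assume "x \<in> S"
        then obtain z T \<sigma> where x: "x = (z, T, \<sigma>)" "z \<in> PiE {..2 * n + 1} (\<lambda>k. {a k, b k})"
          "T \<subseteq> {..n}" "\<sigma> permutes {..n}"
          by (auto simp: S_def)
        show "g x \<in> S"
          using x permutes_le[OF x(4), of 0] by (auto simp: S_def g_def)
        show "g (g x) = x" "g x \<noteq> x"
          using x by (auto simp: g_def)
        have fp: "flag_point n (\<sigma> ` {..<j}) (if \<sigma> 0 \<in> T then T - {\<sigma> 0} else insert (\<sigma> 0) T) z =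
            flag_point n (\<sigma> ` {..<j}) T z" if "j \<noteq> 0" for j
          using that by (intro flag_point_cong) auto
        show "om i (g x) = om i x"
          unfolding om_def x(1) g_def prod.case
          by (rule arg_cong[where f = h], rule flag_omit_cong[OF _ i], rule fp, simp add: 1)
      qed
    next
      case (2 l)
      \<comment> \<open>Exchanging the factors that return at steps \<open>l\<close> and
        \<open>Suc l\<close> changes the flag only at the omitted position
        \<open>Suc l\<close>.\<close>
      define g where "g = (\<lambda>(z :: nat \<Rightarrow> 'a, T :: nat set, \<sigma> :: nat \<Rightarrow> nat).
        (z, T, \<sigma> \<circ> Transposition.transpose l (Suc l)))"
      show ?thesis
      proof (rule sum_involution_bit[OF fin, of g])
        fix x assume "x \<in> S"
        then obtain z T \<sigma> where x: "x = (z, T, \<sigma>)" "z \<in> PiE {..2 * n + 1} (\<lambda>k. {a k, b k})"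
          "T \<subseteq> {..n}" "\<sigma> permutes {..n}"
          by (auto simp: S_def)
        have "Transposition.transpose l (Suc l) permutes {..n}"
          using 2 by (intro permutes_swap_id) auto
        then show "g x \<in> S"
          using x by (auto simp: S_def g_def intro: permutes_compose)
        show "g (g x) = x"
          using x by (auto simp: g_def comp_assoc)
        have "\<sigma> (Suc l) \<noteq> \<sigma> l"
          using inj_eq[OF permutes_inj[OF x(4)], of "Suc l" l] by simp
        then have "(\<sigma> \<circ> Transposition.transpose l (Suc l)) l \<noteq> \<sigma> l"
          by simp
        then have "\<sigma> \<circ> Transposition.transpose l (Suc l) \<noteq> \<sigma>"
          by metis
        then show "g x \<noteq> x"
          by (simp add: x(1) g_def)
        have fp: "(\<sigma> \<circ> Transposition.transpose l (Suc l)) ` {..<j} = \<sigma> ` {..<j}" if "j \<noteq> i" for j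
          unfolding image_comp[symmetric] using that 2 by (simp add: transpose_image_lessThan)
        show "om i (g x) = om i x"
          unfolding om_def x(1) g_def prod.case
          by (rule arg_cong[where f = h], rule flag_omit_cong[OF _ i], simp only: fp not_False_eq_True)
      qed
    next
      case 3
      define k where "k T \<sigma> = free_coord T (\<sigma> n)" for T and \<sigma> :: "nat \<Rightarrow> nat"
      \<comment> \<open>Coordinate \<open>k T \<sigma>\<close> of the last returning factor is
        hidden at all points but the omitted last one. Its two values \<open>a\<close> and
        \<open>b\<close> are exchanged, which has no fixed point as they differ.\<close>
      define g where "g = (\<lambda>(z, T, \<sigma>).
        (z(k T \<sigma> := if z (k T \<sigma>) = a (k T \<sigma>) then b (k T \<sigma>) else a (k T \<sigma>)), T, \<sigma>))"
      show ?thesis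
      proof (rule sum_involution_bit[OF fin, of g])
        fix x assume "x \<in> S"
        then obtain z T \<sigma> where x: "x = (z, T, \<sigma>)" "z \<in> PiE {..2 * n + 1} (\<lambda>k. {a k, b k})"
          "T \<subseteq> {..n}" "\<sigma> permutes {..n}"
          by (auto simp: S_def)
        have k: "k T \<sigma> \<le> 2 * n + 1"
          unfolding k_def by (intro free_coord_le permutes_le[OF x(4)]) simp
        then have zk: "z (k T \<sigma>) \<in> {a (k T \<sigma>), b (k T \<sigma>)}" "a (k T \<sigma>) \<noteq> b (k T \<sigma>)"
          using PiE_mem[OF x(2), of "k T \<sigma>"] ab by auto
        show "g x \<in> S"
          using x k by (auto simp: S_def g_def PiE_iff extensional_def)
        show "g (g x) = x" "g x \<noteq> x"
          using x zk by (auto simp: g_def fun_upd_idem_iff)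
        have fp: "flag_point n (\<sigma> ` {..<j}) T (z(k T \<sigma> := w)) = flag_point n (\<sigma> ` {..<j}) T z"
          if "j \<le> n" for j w
          unfolding k_def using that
          by (intro flag_point_fun_upd permutes_notin_image[OF x(4)]) auto
        show "om i (g x) = om i x"
          unfolding om_def x(1) g_def prod.case
          by (rule arg_cong[where f = h], rule flag_omit_cong[OF _ i], rule fp, simp add: 3)
      qed
    qed
  qed
  have "(\<Sum>(z, T, \<sigma>)\<in>S. coboundary h (flag n T \<sigma> z)) = (\<Sum>x\<in>S. \<Sum>i<n + 2. om i x)"
    by (intro sum.cong) (auto simp: coboundary_bit length_flag om_def)
  also have "\<dots> = (\<Sum>i<n + 2. sum (om i) S)"
    by (rule sum.swap)
  also have "\<dots> = 0"
    using sum0 by (intro sum.neutral) simp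
  finally show ?thesis .
qed

section \<open>The product cocycle on flags\<close>

primrec cup_prod_cochain ::
    "(nat \<Rightarrow> 'y list \<Rightarrow> 'k::comm_ring_1) \<Rightarrow> nat \<Rightarrow> (nat \<Rightarrow> 'y) list \<Rightarrow> 'k" where
  "cup_prod_cochain c 0 = (\<lambda>xs. c 0 (map (\<lambda>u. u 0) xs))"
| "cup_prod_cochain c (Suc m) =
     cup_cochain (Suc m) (cup_prod_cochain c m) (\<lambda>xs. c (Suc m) (map (\<lambda>u. u (Suc m)) xs))"

text \<open>Consecutive factors of the iterated product share one entry, so factor \<open>i\<close>
  starts where factor \<open>i - 1\<close> ends.\<close>

lemma cup_prod_cochain_eq_prod:
  "length xs = m + 2 \<Longrightarrow> cup_prod_cochain c m xs = (\<Prod>i\<le>m. c i [(xs ! i) i, (xs ! Suc i) i])"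
proof (induction m arbitrary: xs)
  case 0
  then obtain x y where "xs = [x, y]"
    by (auto simp: length_Suc_conv numeral_2_eq_2)
  then show ?case
    by simp
next
  case (Suc m)
  have "drop (Suc m) xs = [xs ! Suc m, xs ! Suc (Suc m)]"
    using Suc.prems by (intro nth_equalityI) (auto simp: less_Suc_eq nth_Cons split: nat.split)
  moreover have "cup_prod_cochain c m (take (Suc (Suc m)) xs) =
      (\<Prod>i\<le>m. c i [(xs ! i) i, (xs ! Suc i) i])"
    using Suc.prems by (subst Suc.IH) (auto intro!: prod.cong)
  ultimately show ?case
    by (simp add: cup_cochain_def)
qed

lemma cup_prod_cochain_class:
  assumes "\<And>i. i \<le> m \<Longrightarrow> (\<lambda>xs. c i (map (\<lambda>u. u i) xs)) \<in> cocycles X 1"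
    and "\<And>i. i \<le> m \<Longrightarrow> \<eta> i = cohomology_class X 1 (\<lambda>xs. c i (map (\<lambda>u. u i) xs))"
  shows "cup_prod_cochain c m \<in> cocycles X (m + 1) \<and>
    cup_prod X \<eta> m = cohomology_class X (m + 1) (cup_prod_cochain c m)"
  using assms
proof (induction m)
  case (Suc m)
  then show ?case
    using cup_cocycles[of "cup_prod_cochain c m" X "Suc m" _ 1]
      cup_cohomology_class[of "cup_prod_cochain c m" X m _ 0] by simp
qed simp

lemma prod_if_1_0:
  fixes P :: "'i \<Rightarrow> bool"
  shows "finite I \<Longrightarrow> (\<Prod>i\<in>I. if P i then 1 else 0 :: 'k::comm_semiring_1) =
    (if \<forall>i\<in>I. P i then 1 else 0)"
  by (induction I rule: finite_induct) auto

text \<open>Factor \<open>i\<close> can be nonzero only if component \<open>i\<close> enters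
  \<open>finite_fst\<close> between the points \<open>i\<close> and \<open>i + 1\<close>. This means
  that its first variable was at infinity and that it returns exactly at step \<open>i\<close>; for
  all \<open>i\<close> together this forces \<open>T = {..n}\<close> and
  \<open>\<sigma> = id\<close>.\<close>

lemma cup_prod_cochain_flag:
  fixes g :: "nat \<Rightarrow> 'a \<Rightarrow> 'a \<Rightarrow> 'k::comm_ring_1"
  assumes \<sigma>: "\<sigma> permutes {..n}" and T: "T \<subseteq> {..n}" and z: "\<And>k. k \<le> 2 * n + 1 \<Longrightarrow> z k \<in> A k"
  defines "c \<equiv> \<lambda>i. cech_cochain (finite_fst (A (2 * i)) (A (2 * i + 1)))
      (\<lambda>w. g i (the (fst w)) (the (snd w)))"
  shows "cup_prod_cochain c n (flag n T \<sigma> z) =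
    (if \<sigma> = id \<and> T = {..n} then \<Prod>i\<le>n. g i (z (2 * i)) (z (2 * i + 1)) else 0)"
proof -
  have c: "c i [p, q] = (if p \<in> finite_fst (A (2 * i)) (A (2 * i + 1)) then 0
      else if q \<in> finite_fst (A (2 * i)) (A (2 * i + 1)) then g i (the (fst q)) (the (snd q)) else 0)"
    for i p q
    by (simp add: c_def cech_cochain_def coboundary_Cons coboundary_Nil)
  have factor: "c i [(flag n T \<sigma> z ! i) i, (flag n T \<sigma> z ! Suc i) i] =
      (if \<sigma> i = i \<and> i \<in> T then 1 else 0) * g i (z (2 * i)) (z (2 * i + 1))" if i: "i \<le> n" for i
  proof -
    have fst: "flag_point n S T z i \<in> finite_fst (A (2 * i)) (A (2 * i + 1)) \<longleftrightarrow> i \<in> S \<or> i \<notin> T" for S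
      using z[of "2 * i"] z[of "2 * i + 1"] i
      by (auto simp: finite_fst_def flag_point_def topspace_punctured)
    have nth: "flag n T \<sigma> z ! i = flag_point n (\<sigma> ` {..<i}) T z"
      "flag n T \<sigma> z ! Suc i = flag_point n (\<sigma> ` {..<Suc i}) T z"
      using i by (simp_all add: nth_flag)
    have val: "flag_point n S T z i = (Some (z (2 * i)), Some (z (2 * i + 1)))" if "i \<in> S" for S
      using that i by (simp add: flag_point_def)
    have "c i [(flag n T \<sigma> z ! i) i, (flag n T \<sigma> z ! Suc i) i] =
        (if i \<in> T \<and> i \<notin> \<sigma> ` {..<i} \<and> i \<in> \<sigma> ` {..<Suc i} then g i (z (2 * i)) (z (2 * i + 1)) else 0)"
      unfolding nth c fst using val[of "\<sigma> ` {..<Suc i}"] by auto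
    moreover have "i \<notin> \<sigma> ` {..<i} \<and> i \<in> \<sigma> ` {..<Suc i} \<longleftrightarrow> \<sigma> i = i"
      using permutes_notin_image[OF \<sigma>, of i "{..<i}"] by (auto simp: lessThan_Suc)
    ultimately show ?thesis
      by auto
  qed
  have "cup_prod_cochain c n (flag n T \<sigma> z) =
      (\<Prod>i\<le>n. if \<sigma> i = i \<and> i \<in> T then 1 else 0) * (\<Prod>i\<le>n. g i (z (2 * i)) (z (2 * i + 1)))"
    using factor by (simp add: cup_prod_cochain_eq_prod length_flag prod.distrib)
  moreover have "(\<forall>i\<in>{..n}. \<sigma> i = i \<and> i \<in> T) \<longleftrightarrow> \<sigma> = id \<and> T = {..n}"
    using T permutes_not_in[OF \<sigma>] by (auto simp: fun_eq_iff)
  ultimately show ?thesis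
    by (simp add: prod_if_1_0)
qed

section \<open>Nonvanishing of the product class\<close>

theorem theorem2p12:
  fixes n :: nat and A E F :: "nat \<Rightarrow> 'a set"
  assumes "\<And>k. k \<le> 2 * n + 1 \<Longrightarrow> has_card_aleph k (A k)"
    and "\<And>k. k \<le> 2 * n + 1 \<Longrightarrow> A k = E k \<union> F k \<and> E k \<inter> F k = {} \<and> |E k| =o |F k|"
  shows
    "let U = product_topology (\<lambda>i. punctured (A (2 * i)) (A (2 * i + 1))) {0..n};
         e = (\<lambda>i x y. if x \<in> E (2 * i) \<and> y \<in> E (2 * i + 1) then 1 else 0 :: bit);
         \<epsilon> = (\<lambda>i. represented_class (A (2 * i)) (A (2 * i + 1)) (e i));
         \<eta> = (\<lambda>i. pullback U 1 (\<lambda>u. u i) (\<epsilon> i))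
     in cup_prod U \<eta> n \<in> carrier (cohomology_group U (n + 1)) \<and>
        cup_prod U \<eta> n \<noteq> \<one>\<^bsub>cohomology_group U (n + 1)\<^esub>"
proof -
  define U where "U = punctured_product n A"
  define e where "e i x y = (if x \<in> E (2 * i) \<and> y \<in> E (2 * i + 1) then 1 else 0 :: bit)" for i x y
  define \<eta> where
    "\<eta> i = pullback U 1 (\<lambda>u. u i) (represented_class (A (2 * i)) (A (2 * i + 1)) (e i))" for i
  define c where "c i = cech_cochain (finite_fst (A (2 * i)) (A (2 * i + 1)))
      (\<lambda>w. e i (the (fst w)) (the (snd w)))" for i
  define f where "f = cup_prod_cochain c n"
  have proj: "continuous_map U (punctured (A (2 * i)) (A (2 * i + 1))) (\<lambda>u. u i)" if "i \<le> n" for i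
    unfolding U_def using that by (intro continuous_map_product_projection) simp
  have c: "c i \<in> represented_class (A (2 * i)) (A (2 * i + 1)) (e i)" for i
    unfolding c_def by (rule cech_cochain_in_represented_class)
  have coc: "(\<lambda>xs. c i (map (\<lambda>u. u i) xs)) \<in> cocycles U 1" if "i \<le> n" for i
    by (rule cocycles_map[OF proj[OF that] represented_class_cocycles[OF c]])
  have \<eta>: "\<eta> i = cohomology_class U 1 (\<lambda>xs. c i (map (\<lambda>u. u i) xs))" if "i \<le> n" for i
    unfolding \<eta>_def represented_class_eq_cohomology_class[OF c]
    by (rule pullback_cohomology_class[OF proj[OF that]])
  have f: "f \<in> cocycles U (n + 1)" "cup_prod U \<eta> n = cohomology_class U (n + 1) f"
    using cup_prod_cochain_class[of n c U \<eta>, OF coc \<eta>] by (simp_all add: f_def)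
  have "f \<notin> coboundaries U (n + 1)"
  proof
    assume "f \<in> coboundaries U (n + 1)"
    then obtain h where h: "(\<lambda>xs. f xs - coboundary h xs) \<in> null_sections U (Suc n) (topspace U)"
      by auto
    obtain B where B: "\<forall>k z. finite (B k z)" "\<forall>k z w. B k (z(k := w)) = B k z"
      "\<forall>z T \<sigma>. (\<forall>k\<le>2 * n + 1. z k \<in> A k \<and> z k \<notin> B k z) \<longrightarrow> T \<subseteq> {..n} \<longrightarrow> \<sigma> permutes {..n} \<longrightarrow>
        f (flag n T \<sigma> z) - coboundary h (flag n T \<sigma> z) = 0"
      by (rule null_section_flag_exceptions[OF h[unfolded U_def]])
    have EF: "A k = E k \<union> F k \<and> |E k| =o |F k|" if "k \<le> 2 * n + 1" for k
      using assms(2)[OF that] by simp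
    \<comment> \<open>The box avoids the exceptional sets of the difference of \<open>f\<close> and
      \<open>coboundary h\<close>, so both agree on every flag of each of its points.\<close>
    obtain a b where "\<forall>k\<le>2 * n + 1. a k \<in> E k \<and> b k \<in> F k"
      and good: "\<forall>z\<in>PiE {..2 * n + 1} (\<lambda>k. {a k, b k}). \<forall>k\<le>2 * n + 1. z k \<notin> B k z"
      by (rule good_box[OF assms(1) EF B(1)[rule_format] B(2)[rule_format]])
    then have ab: "a k \<in> E k \<and> b k \<in> F k" if "k \<le> 2 * n + 1" for k
      using that by blast
    have neq: "a k \<noteq> b k" if "k \<le> 2 * n + 1" for k
      using ab[OF that] assms(2)[OF that] by auto
    define Z where "Z = PiE {..2 * n + 1} (\<lambda>k. {a k, b k})"
    define S where "S = Z \<times> Pow {..n} \<times> {\<sigma>. \<sigma> permutes {..n}}"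
    have fin: "finite S"
      unfolding S_def Z_def
      by (intro finite_cartesian_product finite_PiE) (simp_all add: finite_permutations)
    have ZA: "z k \<in> A k" if "z \<in> Z" "k \<le> 2 * n + 1" for z k
      using PiE_mem[OF that(1)[unfolded Z_def], of k] that(2) ab[of k] assms(2)[of k] by auto
    have zE: "z k \<in> E k \<longleftrightarrow> z k = a k" if "z \<in> Z" "k \<le> 2 * n + 1" for z k
      using PiE_mem[OF that(1)[unfolded Z_def], of k] that(2) ab[of k] assms(2)[of k] by auto
    \<comment> \<open>The restriction makes the corner \<open>a\<close> an element of the
      extensional product \<open>Z\<close>.\<close>
    define a' where "a' = restrict a {..2 * n + 1}"
    have a': "a' \<in> Z"
      by (auto simp: a'_def Z_def)
    \<comment> \<open>Of the two choices \<open>a k\<close> and \<open>b k\<close> only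
      \<open>a k\<close> lies in \<open>E k\<close>, so the product of the indicators
      \<open>e i\<close> detects the corner \<open>a'\<close>.\<close>
    have prod_e: "(\<Prod>i\<le>n. e i (z (2 * i)) (z (2 * i + 1))) = (if z = a' then 1 else 0)"
      if z: "z \<in> Z" for z
    proof -
      have "(\<forall>i\<in>{..n}. z (2 * i) \<in> E (2 * i) \<and> z (2 * i + 1) \<in> E (2 * i + 1)) \<longleftrightarrow>
          (\<forall>k\<in>{..2 * n + 1}. z k = a k)"
      proof (intro iffI ballI)
        fix k
        assume *: "\<forall>i\<in>{..n}. z (2 * i) \<in> E (2 * i) \<and> z (2 * i + 1) \<in> E (2 * i + 1)"
          and k: "k \<in> {..2 * n + 1}"
        obtain i where "i \<le> n" "k = 2 * i \<or> k = 2 * i + 1"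
          using k by (auto elim!: evenE oddE[of k] intro: that[of "k div 2"])
        then show "z k = a k"
          using * zE[OF z, of k] k by auto
      qed (use zE[OF z] in auto)
      also have "\<dots> \<longleftrightarrow> z = a'"
        using z by (auto simp: a'_def Z_def fun_eq_iff PiE_iff extensional_def)
      finally show ?thesis
        by (simp add: e_def prod_if_1_0)
    qed
    have "(\<Sum>(z, T, \<sigma>)\<in>S. f (flag n T \<sigma> z)) = (\<Sum>(z, T, \<sigma>)\<in>S. coboundary h (flag n T \<sigma> z))"
    proof (intro sum.cong refl)
      fix x assume "x \<in> S"
      then obtain z T \<sigma> where x: "x = (z, T, \<sigma>)" "z \<in> Z" "T \<subseteq> {..n}" "\<sigma> permutes {..n}"
        by (auto simp: S_def)
      show "(case x of (z, T, \<sigma>) \<Rightarrow> f (flag n T \<sigma> z)) =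
          (case x of (z, T, \<sigma>) \<Rightarrow> coboundary h (flag n T \<sigma> z))"
        using B(3)[rule_format, OF _ x(3,4), of z] ZA[OF x(2)] good x(2)
        unfolding x(1) Z_def prod.case right_minus_eq by blast
    qed
    also have "\<dots> = 0"
      unfolding S_def Z_def by (rule sum_flag_coboundary[OF neq])
    finally have "(\<Sum>(z, T, \<sigma>)\<in>S. f (flag n T \<sigma> z)) = 0" .
    \<comment> \<open>A single flag contributes, so the same sum is 1, against the value 0 just
      found.\<close>
    moreover have "(\<Sum>(z, T, \<sigma>)\<in>S. f (flag n T \<sigma> z)) =
        (\<Sum>x\<in>S. if x = (a', {..n}, id) then 1 else 0)"
    proof (intro sum.cong refl)
      fix x assume "x \<in> S"
      then obtain z T \<sigma> where x: "x = (z, T, \<sigma>)" "z \<in> Z" "T \<subseteq> {..n}" "\<sigma> permutes {..n}"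
        by (auto simp: S_def)
      have "f (flag n T \<sigma> z) = (if \<sigma> = id \<and> T = {..n} then if z = a' then 1 else 0 else 0)"
        unfolding f_def c_def prod_e[OF x(2), symmetric]
        by (rule cup_prod_cochain_flag[OF x(4,3) ZA[OF x(2)]])
      then show "(case x of (z, T, \<sigma>) \<Rightarrow> f (flag n T \<sigma> z)) = (if x = (a', {..n}, id) then 1 else 0)"
        using x(1) by auto
    qed
    moreover have "(a', {..n}, id) \<in> S"
      using a' by (simp add: S_def permutes_id)
    ultimately show False
      using fin by simp
  qed
  \<comment> \<open>The unit of the quotient group is \<open>coboundaries\<close> itself;
    \<open>f\<close> lies in its own class but not in this subgroup.\<close>
  then have "cohomology_class U (n + 1) f \<noteq> coboundaries U (n + 1)"
    using cohomology_class_self[of f U "n + 1"] by auto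
  moreover have "cohomology_class U (n + 1) f \<in> carrier (cohomology_group U (n + 1))"
    using f(1) by (auto simp: cohomology_group_def FactGroup_def RCOSETS_def cohomology_class_def
        cocycle_group_def)
  ultimately have "cup_prod U \<eta> n \<in> carrier (cohomology_group U (n + 1)) \<and>
      cup_prod U \<eta> n \<noteq> \<one>\<^bsub>cohomology_group U (n + 1)\<^esub>"
    unfolding f(2) by (simp add: cohomology_group_def FactGroup_def)
  then show ?thesis
    unfolding Let_def U_def \<eta>_def[abs_def] e_def[abs_def] .
qed

end
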